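(* Let $\Omega\subsetneq\mathbb{C}$ be a simply connected Smirnov domain which is exceptional (in the weak sense), and let $h:\mathbb{D}\to\Omega$ be a conformal map. If $h'$ (which is rational) has exactly two poles on $\partial\mathbb{D}$, then, up to similarity, $\Omega$ is the image of the strip $\{w:|\Im w|<\pi/2\}$ under the conformal map $g(w)=w+\sinh(w)$, and the analytic completion $f=u+iv$ of the roof function $u$ satisfies (after the same similarity and up to a positive multiple and an additive imaginary constant) $f(g(w))=\cosh(w)$.
   Context: $\Omega$ is exceptional in the weak sense if there is a positive harmonic function $u$ on $\Omega$ whose boundary values are $0$ and whose normal derivative is a nonzero constant almost everywhere with respect to arclength on $\partial\Omega$; its analytic completion is $f=u+iv$ with $v$ a harmonic conjugate. $\Omega$ is Smirnov if $h'$ is an outer function (no singular inner factor in its canonical factorization). *)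

theory Defs
  imports "HOL-Analysis.Analysis" "HOL-Computational_Algebra.Polynomial_Factorial"
begin

definition pdx :: "(complex \<Rightarrow> real) \<Rightarrow> complex \<Rightarrow> real" where
  "pdx u z = frechet_derivative u (at z) 1"

definition pdy :: "(complex \<Rightarrow> real) \<Rightarrow> complex \<Rightarrow> real" where
  "pdy u z = frechet_derivative u (at z) \<i>"

definition harmonic_on :: "complex set \<Rightarrow> (complex \<Rightarrow> real) \<Rightarrow> bool" where
  "harmonic_on S u \<longleftrightarrow> open S \<and>
     (\<forall>z\<in>S. u differentiable (at z) \<and> pdx u differentiable (at z) \<and> pdy u differentiable (at z)) \<and>
     continuous_on S (pdx (pdx u)) \<and> continuous_on S (pdy (pdx u)) \<and>
     continuous_on S (pdx (pdy u)) \<and> continuous_on S (pdy (pdy u)) \<and>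
     (\<forall>z\<in>S. pdx (pdx u) z + pdy (pdy u) z = 0)"

definition grad_norm :: "(complex \<Rightarrow> real) \<Rightarrow> complex \<Rightarrow> real" where
  "grad_norm u z = sqrt ((pdx u z)\<^sup>2 + (pdy u z)\<^sup>2)"

definition h1_null :: "complex set \<Rightarrow> bool" where
  "h1_null E \<longleftrightarrow> (\<forall>\<epsilon>>0. \<exists>(c::nat \<Rightarrow> complex) (r::nat \<Rightarrow> real).
      (\<forall>n. r n \<ge> 0) \<and> E \<subseteq> (\<Union>n. ball (c n) (r n)) \<and> summable r \<and> (\<Sum>n. 2 * r n) < \<epsilon>)"

definition nt_region :: "complex set \<Rightarrow> real \<Rightarrow> complex \<Rightarrow> complex set" where
  "nt_region \<Omega> M \<zeta> = {z \<in> \<Omega>. dist z \<zeta> < M * infdist z (frontier \<Omega>)}"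

text \<open>The (inner) normal derivative of u at the boundary point \<zeta> equals c, in the weak sense:
  nontangential boundary limit of the length of the gradient (u vanishes on the boundary,
  so the gradient is normal there).\<close>
definition normal_derivative_is :: "complex set \<Rightarrow> (complex \<Rightarrow> real) \<Rightarrow> complex \<Rightarrow> real \<Rightarrow> bool" where
  "normal_derivative_is \<Omega> u \<zeta> c \<longleftrightarrow>
     (\<forall>M>1. (grad_norm u \<longlongrightarrow> c) (at \<zeta> within nt_region \<Omega> M \<zeta>))"

definition roof_function :: "complex set \<Rightarrow> (complex \<Rightarrow> real) \<Rightarrow> bool" where
  "roof_function \<Omega> u \<longleftrightarrow> harmonic_on \<Omega> u \<and> (\<forall>z\<in>\<Omega>. u z > 0) \<and>
     (\<forall>\<zeta>\<in>frontier \<Omega>. (u \<longlongrightarrow> 0) (at \<zeta> within \<Omega>)) \<and>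
     (\<exists>c. c \<noteq> 0 \<and> (\<exists>N. h1_null N \<and> (\<forall>\<zeta>\<in>frontier \<Omega> - N. normal_derivative_is \<Omega> u \<zeta> c)))"

definition exceptional_weak :: "complex set \<Rightarrow> bool" where
  "exceptional_weak \<Omega> \<longleftrightarrow> (\<exists>u. roof_function \<Omega> u)"

definition outer_function :: "(complex \<Rightarrow> complex) \<Rightarrow> bool" where
  "outer_function F \<longleftrightarrow> (\<exists>(k::real \<Rightarrow> real) \<gamma>. set_integrable lborel {0..2*pi} k \<and> cmod \<gamma> = 1 \<and>
     (\<forall>z\<in>ball 0 1. F z = \<gamma> * exp (complex_of_real (1 / (2*pi)) *
        set_lebesgue_integral lborel {0..2*pi}
          (\<lambda>t. ((cis t + z) / (cis t - z)) * complex_of_real (k t)))))"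

text \<open>Smirnov domain, relative to a conformal map h of the disc onto it.\<close>
definition smirnov_map :: "(complex \<Rightarrow> complex) \<Rightarrow> bool" where
  "smirnov_map h \<longleftrightarrow> outer_function (deriv h)"

definition strip :: "complex set" where
  "strip = {w. \<bar>Im w\<bar> < pi / 2}"

definition gmap :: "complex \<Rightarrow> complex" where
  "gmap w = w + sinh w"

end

(*
  Let u be a roof function, U its pullback to the disc by h, and F the holomorphic function on the
  disc with real part U.  At every point of the unit circle that is not a pole of h' = p/q the map
  h extends analytically and its value lies on the boundary of the domain, so U vanishes there.
  A nonnegative harmonic function whose boundary values vanish off two points a1, a2 is a
  nonnegative combination of the two Poisson kernels there.  Bloch's covering lemma makes the
  images of radii nontangential, hence |F'| = c |h'| on the circle; this forces both weights to be
  positive, since otherwise h' would have no pole at a1 or a2.  Let om be the Moebius map onto the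
  right half-plane with pole a1 and zero a2, suitably scaled; then F = C (om + 1/om) up to an
  imaginary constant.  On the circle om is imaginary, so |om^2 - 1| = |om + 1|^2, and h' and
  (1 + om)^2 om'/om^2 have proportional moduli there.  Both are zero-free in the disc, so they are
  proportional, and integrating in the variable w = Ln om gives h = a (w + sinh w) + b and
  F = 2 C cosh w.
*)
theory Submission
  imports Defs "HOL-Complex_Analysis.Complex_Analysis" "HOL-Real_Asymp.Real_Asymp"
begin

section \<open>Null sets for linear measure\<close>

text \<open>The normal derivative is controlled only nontangentially and only off a null set
  \<open>N\<close> of boundary points, while nothing is known beforehand about the shape of the
  boundary. Near a circle point where \<open>p\<close> and \<open>q\<close> do not vanish, the
  extended \<open>h\<close> carries an arc to a connected set with more than one point, which a null
  set cannot contain; so usable points are dense on the circle. The relation of moduli is written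
  with denominators cleared, as an equality between polynomials, and continuity then gives it on the
  whole circle, poles included. The passage from \<open>om^2 - 1\<close> to
  \<open>(om + 1)^2\<close> is what makes the maximum principle applicable: \<open>F'\<close>
  vanishes inside the disc where the scaled \<open>om\<close> equals 1, whereas \<open>h'\<close>
  has no zero there, and the value -1 is never taken in the right half-plane. The scale of
  \<open>om\<close> comes from the weights of one roof function, but the similarity has to serve all
  of them. It does because \<open>h'\<close> alone determines the scale.\<close>

lemma real_interval_covered_imp_long:
  fixes c r :: "nat \<Rightarrow> real"
  assumes "x \<le> y" and cov: "{x..y} \<subseteq> (\<Union>n. {c n - r n <..< c n + r n})"
    and r0: "\<And>n. r n \<ge> 0" and sm: "summable r"
  shows "y - x \<le> (\<Sum>n. 2 * r n)"
proof -
  have "ennreal (y - x) = emeasure lborel {x..y}"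
    using assms(1) by simp
  also have "\<dots> \<le> emeasure lborel (\<Union>n. {c n - r n <..< c n + r n})"
    by (rule emeasure_mono[OF cov]) auto
  also have "\<dots> \<le> (\<Sum>n. emeasure lborel {c n - r n <..< c n + r n})"
    by (rule emeasure_subadditive_countably) auto
  also have "\<dots> = (\<Sum>n. ennreal (2 * r n))"
    using r0 by (simp add: emeasure_lborel_Ioo algebra_simps)
  also have "\<dots> = ennreal (\<Sum>n. 2 * r n)"
    by (rule suminf_ennreal2) (use r0 sm in auto)
  finally show ?thesis
    using r0 sm by (simp add: ennreal_le_iff suminf_nonneg)
qed

text \<open>A linear functional that does not increase lengths sends a ball of radius
  \<open>r\<close> into an interval of length \<open>2 * r\<close>, and sends the connected set onto
  an interval. Covers of arbitrarily small total length would then cover an interval of fixed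
  positive length.\<close>

lemma h1_null_connected_linear_image:
  fixes L :: "complex \<Rightarrow> real"
  assumes lin: "bounded_linear L" and L: "\<And>z. \<bar>L z\<bar> \<le> cmod z"
    and N: "h1_null N" and S: "connected S" "S \<subseteq> N" and xy: "x \<in> S" "y \<in> S"
  shows "L x = L y"
proof -
  interpret bounded_linear L by (rule lin)
  have *: False if lt: "L x < L y" and xy: "x \<in> S" "y \<in> S" for x y
  proof -
    from N obtain c r where r0: "\<And>n. r n \<ge> (0::real)"
      and cov: "N \<subseteq> (\<Union>n. ball (c n) (r n))" and sm: "summable r" 
      and less: "(\<Sum>n. 2 * r n) < L y - L x"
      unfolding h1_null_def using lt by (meson diff_gt_0_iff_gt)
    have "connected (L ` S)"
      using S(1) by (intro connected_continuous_image linear_continuous_on lin)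
    then have "{L x..L y} \<subseteq> L ` S"
      using xy by (intro connected_contains_Icc) auto
    also have "\<dots> \<subseteq> (\<Union>n. {L (c n) - r n <..< L (c n) + r n})"
    proof clarsimp
      fix z assume "z \<in> S"
      then obtain n where "z \<in> ball (c n) (r n)" using S(2) cov by blast
      then have "\<bar>L (z - c n)\<bar> < r n"
        using L[of "z - c n"] by (simp add: dist_norm norm_minus_commute)
      then show "\<exists>n. L (c n) - r n < L z \<and> L z < L (c n) + r n"
        by (intro exI[of _ n]) (simp add: diff abs_less_iff)
    qed
    finally show False
      using real_interval_covered_imp_long[of "L x" "L y" "\<lambda>n. L (c n)" r] r0 sm less lt by force
  qed
  show ?thesis using *[of x y] *[of y x] xy by (meson linorder_neqE_linordered_idom)
qed

lemma h1_null_connected_imp_eq: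
  assumes "h1_null N" "connected S" "S \<subseteq> N" "x \<in> S" "y \<in> S"
  shows "x = y"
  using h1_null_connected_linear_image[OF bounded_linear_Re abs_Re_le_cmod assms]
    h1_null_connected_linear_image[OF bounded_linear_Im abs_Im_le_cmod assms]
  by (simp add: complex_eq_iff)

section \<open>Analytic completion of harmonic functions\<close>

lemma has_real_derivative_pdx:
  assumes "u differentiable (at (Complex x y))"
  shows "((\<lambda>x. u (Complex x y)) has_real_derivative pdx u (Complex x y)) (at x)"
proof -
  let ?D = "frechet_derivative u (at (Complex x y))"
  have D: "(u has_derivative ?D) (at (Complex x y))"
    using assms frechet_derivative_works by blast
  have "((\<lambda>x. Complex x y) has_derivative (\<lambda>t. of_real t)) (at x)"
    by (auto simp: Complex_eq intro!: derivative_eq_intros)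
  from diff_chain_at[OF this] D
  have "((\<lambda>x. u (Complex x y)) has_derivative (\<lambda>t. ?D (of_real t))) (at x)"
    by (auto simp: o_def)
  moreover have "?D (of_real t) = pdx u (Complex x y) * t" for t
    using linear_scale[OF has_derivative_linear[OF D], of t 1]
    by (simp add: pdx_def scaleR_conv_of_real)
  ultimately show ?thesis by (simp add: has_field_derivative_def)
qed

lemma has_real_derivative_pdy:
  assumes "u differentiable (at (Complex x y))"
  shows "((\<lambda>y. u (Complex x y)) has_real_derivative pdy u (Complex x y)) (at y)"
proof -
  let ?D = "frechet_derivative u (at (Complex x y))"
  have D: "(u has_derivative ?D) (at (Complex x y))"
    using assms frechet_derivative_works by blast
  have "((\<lambda>y. Complex x y) has_derivative (\<lambda>t. \<i> * of_real t)) (at y)"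
    by (auto simp: Complex_eq intro!: derivative_eq_intros)
  from diff_chain_at[OF this] D
  have "((\<lambda>y. u (Complex x y)) has_derivative (\<lambda>t. ?D (\<i> * of_real t))) (at y)"
    by (auto simp: o_def)
  moreover have "?D (\<i> * of_real t) = pdy u (Complex x y) * t" for t
    using linear_scale[OF has_derivative_linear[OF D], of t \<i>]
    by (simp add: pdy_def scaleR_conv_of_real mult.commute)
  ultimately show ?thesis by (simp add: has_field_derivative_def)
qed

lemma Complex_in_ball:
  assumes "\<bar>s - x\<bar> + \<bar>t - y\<bar> < e"
  shows "Complex s t \<in> ball (Complex x y) e"
proof -
  have "cmod (Complex s t - Complex x y) \<le> \<bar>s - x\<bar> + \<bar>t - y\<bar>"
    using cmod_le[of "Complex s t - Complex x y"] by simp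
  then show ?thesis using assms by (simp add: dist_norm norm_minus_commute)
qed

text \<open>The mean value theorem is used twice: for the increment over the vertical side as a
  function of the first coordinate, then for \<open>pdx u\<close> in the second. The primed version
  takes the coordinates in the other order and produces the other mixed partial from the same second
  difference.\<close>

lemma second_difference_eq_mixed_partial:
  assumes S: "ball (Complex x y) (2 * e) \<subseteq> S" and e: "e > 0"
    and d: "\<And>z. z \<in> S \<Longrightarrow> u differentiable (at z)"
    and d1: "\<And>z. z \<in> S \<Longrightarrow> pdx u differentiable (at z)"
    and h: "0 < h" "h < e"
  shows "\<exists>z \<in> ball (Complex x y) (2*h). u (Complex (x+h) (y+h)) - u (Complex (x+h) y) - u (Complex x (y+h)) + u (Complex x y)
      = h * h * pdy (pdx u) z"
proof -
  have inS: "Complex s t \<in> S" if "x \<le> s" "s \<le> x+h" "y \<le> t" "t \<le> y+h" for s t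
    using that h by (intro subsetD[OF S] Complex_in_ball) auto
  have "\<exists>s>x. s < x+h \<and> (u (Complex (x+h) (y+h)) - u (Complex (x+h) y)) - (u (Complex x (y+h)) - u (Complex x y)) 
     = (x+h-x) * (pdx u (Complex s (y+h)) - pdx u (Complex s y))"
    using h by (intro MVT2 DERIV_diff has_real_derivative_pdx d inS) auto
  then obtain s where s: "x < s" "s < x+h" 
    and 1: "(u (Complex (x+h) (y+h)) - u (Complex (x+h) y)) - (u (Complex x (y+h)) - u (Complex x y)) 
     = h * (pdx u (Complex s (y+h)) - pdx u (Complex s y))" by auto
  have "\<exists>t>y. t < y+h \<and> pdx u (Complex s (y+h)) - pdx u (Complex s y) = (y+h-y) * pdy (pdx u) (Complex s t)"
    using h s by (intro MVT2 has_real_derivative_pdy d1 inS) auto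
  then obtain t where t: "y < t" "t < y + h" 
    and 2: "pdx u (Complex s (y+h)) - pdx u (Complex s y) = h * pdy (pdx u) (Complex s t)" by auto
  have "Complex s t \<in> ball (Complex x y) (2*h)"
    using s t by (intro Complex_in_ball) auto
  then show ?thesis using 1 2 by (intro bexI[of _ "Complex s t"]) (auto simp: algebra_simps)
qed

lemma second_difference_eq_mixed_partial':
  assumes S: "ball (Complex x y) (2 * e) \<subseteq> S" and e: "e > 0"
    and d: "\<And>z. z \<in> S \<Longrightarrow> u differentiable (at z)"
    and d1: "\<And>z. z \<in> S \<Longrightarrow> pdy u differentiable (at z)"
    and h: "0 < h" "h < e"
  shows "\<exists>z \<in> ball (Complex x y) (2*h). u (Complex (x+h) (y+h)) - u (Complex (x+h) y) - u (Complex x (y+h)) + u (Complex x y)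
      = h * h * pdx (pdy u) z"
proof -
  have inS: "Complex s t \<in> S" if "x \<le> s" "s \<le> x+h" "y \<le> t" "t \<le> y+h" for s t
    using that h by (intro subsetD[OF S] Complex_in_ball) auto
  have "\<exists>t>y. t < y+h \<and> (u (Complex (x+h) (y+h)) - u (Complex x (y+h))) - (u (Complex (x+h) y) - u (Complex x y)) 
     = (y+h-y) * (pdy u (Complex (x+h) t) - pdy u (Complex x t))"
    using h by (intro MVT2 DERIV_diff has_real_derivative_pdy d inS) auto
  then obtain t where t: "y < t" "t < y+h" 
    and 1: "(u (Complex (x+h) (y+h)) - u (Complex x (y+h))) - (u (Complex (x+h) y) - u (Complex x y)) 
     = h * (pdy u (Complex (x+h) t) - pdy u (Complex x t))" by auto
  have "\<exists>s>x. s < x+h \<and> pdy u (Complex (x+h) t) - pdy u (Complex x t) = (x+h-x) * pdx (pdy u) (Complex s t)"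
    using h t by (intro MVT2 has_real_derivative_pdx d1 inS) auto
  then obtain s where s: "x < s" "s < x + h" 
    and 2: "pdy u (Complex (x+h) t) - pdy u (Complex x t) = h * pdx (pdy u) (Complex s t)" by auto
  have "Complex s t \<in> ball (Complex x y) (2*h)"
    using s t by (intro Complex_in_ball) auto
  then show ?thesis using 1 2 by (intro bexI[of _ "Complex s t"]) (auto simp: algebra_simps)
qed

text \<open>Both mixed partials represent the same second difference over squares shrinking to
  \<open>z\<close>, at points that converge to \<open>z\<close>; continuity gives equality in the
  limit. \<open>harmonic_on\<close> supplies the continuity but does not state the symmetry.\<close>

lemma mixed_partials_commute:
  assumes S: "open S" "z \<in> S" 
    and d: "\<And>z. z \<in> S \<Longrightarrow> u differentiable (at z)"
    and dx: "\<And>z. z \<in> S \<Longrightarrow> pdx u differentiable (at z)"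
    and dy: "\<And>z. z \<in> S \<Longrightarrow> pdy u differentiable (at z)"
    and cx: "continuous_on S (pdy (pdx u))" and cy: "continuous_on S (pdx (pdy u))"
  shows "pdy (pdx u) z = pdx (pdy u) z"
proof -
  obtain x y where z: "z = Complex x y" by (cases z)
  obtain e0 where e0: "e0 > 0" "ball z e0 \<subseteq> S" using S open_contains_ball by blast
  define e where "e = e0 / 2"
  have e: "e > 0" "ball (Complex x y) (2*e) \<subseteq> S" using e0 by (auto simp: e_def z)
  \<comment> \<open>The shift by 2 keeps \<open>h n\<close> strictly below \<open>e\<close> already
    at \<open>n = 0\<close>.\<close>
  define h where "h n = e / real (n + 2)" for n
  have h: "0 < h n" "h n < e" for n
    using e mult_strict_left_mono[of 1 "real (n + 2)" e] by (simp_all add: h_def divide_less_eq)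
  have h0: "h \<longlonglongrightarrow> 0" unfolding h_def by real_asymp
  have "\<exists>a b. a \<in> ball z (2 * h n) \<and> b \<in> ball z (2 * h n) \<and> pdy (pdx u) a = pdx (pdy u) b" for n
  proof -
    let ?H = "u (Complex (x+h n) (y+h n)) - u (Complex (x+h n) y) - u (Complex x (y+h n)) + u (Complex x y)"
    have "\<exists>a\<in>ball z (2 * h n). ?H = h n * h n * pdy (pdx u) a"
      unfolding z by (rule second_difference_eq_mixed_partial[OF e(2) e(1) d dx h])
    then obtain a where a: "a \<in> ball z (2 * h n)" "?H = h n * h n * pdy (pdx u) a" ..
    have "\<exists>b\<in>ball z (2 * h n). ?H = h n * h n * pdx (pdy u) b"
      unfolding z by (rule second_difference_eq_mixed_partial'[OF e(2) e(1) d dy h])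
    then obtain b where b: "b \<in> ball z (2 * h n)" "?H = h n * h n * pdx (pdy u) b" ..
    have "h n * h n * pdy (pdx u) a = h n * h n * pdx (pdy u) b" using a(2) b(2) by (rule trans[OF sym])
    then have "pdy (pdx u) a = pdx (pdy u) b" using h(1)[of n] by simp
    with a(1) b(1) show ?thesis by (intro exI[of _ a] exI[of _ b] conjI)
  qed
  then obtain a b where ab: "\<And>n. a n \<in> ball z (2 * h n)" "\<And>n. b n \<in> ball z (2 * h n)" 
    and eq: "\<And>n. pdy (pdx u) (a n) = pdx (pdy u) (b n)" by metis
  have lim: "f \<longlonglongrightarrow> z" if "\<And>n. f n \<in> ball z (2 * h n)" for f
  proof (rule metric_tendsto_imp_tendsto)
    show "(\<lambda>n. 2 * h n) \<longlonglongrightarrow> 0" using tendsto_mult[OF tendsto_const h0, of 2] by simp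
    have "dist (f n) z \<le> dist (2 * h n) 0" for n
      using that[of n] h(1)[of n] by (simp add: dist_commute)
    then show "\<forall>\<^sub>F n in sequentially. dist (f n) z \<le> dist (2 * h n) 0" by simp
  qed
  have "(\<lambda>n. pdy (pdx u) (a n)) \<longlonglongrightarrow> pdy (pdx u) z"
    using cx S lim[OF ab(1)] by (metis continuous_on_eq_continuous_at isCont_tendsto_compose)
  moreover have "(\<lambda>n. pdx (pdy u) (b n)) \<longlonglongrightarrow> pdx (pdy u) z"
    using cy S lim[OF ab(2)] by (metis continuous_on_eq_continuous_at isCont_tendsto_compose)
  ultimately show ?thesis using eq LIMSEQ_unique by simp
qed


section \<open>The complex gradient and its primitive on the disc\<close>

lemma has_derivative_partials:
  assumes "u differentiable (at z)"
  shows "(u has_derivative (\<lambda>h. pdx u z * Re h + pdy u z * Im h)) (at z)"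
proof -
  let ?D = "frechet_derivative u (at z)"
  have D: "(u has_derivative ?D) (at z)"
    using assms frechet_derivative_works by blast
  then have lin: "linear ?D" by (rule has_derivative_linear)
  have "?D h = pdx u z * Re h + pdy u z * Im h" for h
  proof -
    have "h = Re h *\<^sub>R 1 + Im h *\<^sub>R \<i>" by (simp add: complex_eq_iff)
    then have "?D h = ?D (Re h *\<^sub>R 1 + Im h *\<^sub>R \<i>)" by simp
    also have "\<dots> = Re h * ?D 1 + Im h * ?D \<i>"
      by (simp add: linear_add[OF lin] linear_scale[OF lin])
    finally show ?thesis by (simp add: pdx_def pdy_def mult.commute)
  qed
  then have "?D = (\<lambda>h. pdx u z * Re h + pdy u z * Im h)" by blast
  with D show ?thesis by simp
qed

text \<open>This is the derivative of an analytic completion of \<open>u\<close>, expressed through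
  \<open>u\<close> alone. It is available without a global harmonic conjugate, and its modulus is
  the quantity in the boundary condition.\<close>

definition cgrad :: "(complex \<Rightarrow> real) \<Rightarrow> complex \<Rightarrow> complex" where
  "cgrad u z = of_real (pdx u z) - \<i> * of_real (pdy u z)"

lemma cmod_cgrad: "cmod (cgrad u z) = grad_norm u z"
  by (simp add: cgrad_def grad_norm_def cmod_def)

lemma has_derivative_cgrad:
  assumes "u differentiable (at z)"
  shows "(u has_derivative (\<lambda>h. Re (cgrad u z * h))) (at z)"
  using has_derivative_partials[OF assms] by (simp add: cgrad_def)

text \<open>The Cauchy-Riemann equations for \<open>cgrad u\<close> are Laplace's equation and the
  symmetry of the mixed partials.\<close>

lemma cgrad_holomorphic:
  assumes "harmonic_on S u"
  shows "cgrad u holomorphic_on S"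
proof -
  have S: "open S" and d: "\<And>z. z \<in> S \<Longrightarrow> u differentiable (at z)"
    and dx: "\<And>z. z \<in> S \<Longrightarrow> pdx u differentiable (at z)"
    and dy: "\<And>z. z \<in> S \<Longrightarrow> pdy u differentiable (at z)"
    and lap: "\<And>z. z \<in> S \<Longrightarrow> pdx (pdx u) z + pdy (pdy u) z = 0"
    and comm: "\<And>z. z \<in> S \<Longrightarrow> pdy (pdx u) z = pdx (pdy u) z"
    using assms mixed_partials_commute[of S _ u] unfolding harmonic_on_def by blast+
  have "(cgrad u has_field_derivative Complex (pdx (pdx u) z) (- pdy (pdx u) z)) (at z)" if "z \<in> S" for z
  proof -
    have "(cgrad u has_derivative (\<lambda>h. of_real (pdx (pdx u) z * Re h + pdy (pdx u) z * Im h)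
        - \<i> * of_real (pdx (pdy u) z * Re h + pdy (pdy u) z * Im h))) (at z)"
      unfolding cgrad_def using that
      by (intro derivative_intros has_derivative_partials d dx dy)
    also have "(\<lambda>h. of_real (pdx (pdx u) z * Re h + pdy (pdx u) z * Im h)
        - \<i> * of_real (pdx (pdy u) z * Re h + pdy (pdy u) z * Im h)) = 
        (*) (Complex (pdx (pdx u) z) (- pdy (pdx u) z))"
    proof -
      have "pdy (pdy u) z = - pdx (pdx u) z" using lap[OF that] by linarith
      then show ?thesis using comm[OF that] by (auto simp: fun_eq_iff complex_eq_iff algebra_simps)
    qed
    finally show ?thesis by (simp add: has_field_derivative_def)
  qed
  then show ?thesis using S by (auto simp: holomorphic_on_open)
qed

text \<open>The difference takes only imaginary values, so its image is not open, and the open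
  mapping theorem forces it to be constant.\<close>

lemma holomorphic_Re_eq_imp_diff_const:
  assumes D: "open D" "connected D" "D \<noteq> {}" and f: "f holomorphic_on D" and g: "g holomorphic_on D"
    and eq: "\<And>z. z \<in> D \<Longrightarrow> Re (f z) = Re (g z)"
  shows "\<exists>k::real. \<forall>z\<in>D. f z = g z + \<i> * of_real k"
proof -
  have hol: "(\<lambda>z. f z - g z) holomorphic_on D" by (intro holomorphic_intros f g)
  have "(\<lambda>z. f z - g z) constant_on D"
  proof (rule ccontr)
    assume "\<not> (\<lambda>z. f z - g z) constant_on D"
    then have "open ((\<lambda>z. f z - g z) ` D)"
      using open_mapping_thm[OF hol D(1,2) D(1)] by blast
    moreover obtain z where z: "z \<in> D" using D by blast
    ultimately obtain e where e: "e > 0" "ball (f z - g z) e \<subseteq> (\<lambda>z. f z - g z) ` D"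
      by (meson imageI open_contains_ball)
    have "f z - g z + of_real (e/2) \<in> ball (f z - g z) e" using e by (simp add: dist_norm)
    with e obtain y where "y \<in> D" "f z - g z + of_real (e/2) = f y - g y" by blast
    then have "Re (f z) - Re (g z) + e/2 = Re (f y) - Re (g y)"
      by (metis Re_complex_of_real minus_complex.simps(1) plus_complex.simps(1))
    with eq[OF z] eq[OF \<open>y \<in> D\<close>] e(1) show False by simp
  qed
  then obtain c where c: "\<And>z. z \<in> D \<Longrightarrow> f z - g z = c" unfolding constant_on_def by blast
  obtain w where "w \<in> D" using D by blast
  then have "Re c = 0" using c[of w] eq[of w] by force
  then have "c = \<i> * of_real (Im c)" by (simp add: complex_eq_iff)
  then show ?thesis using c by (intro exI[of _ "Im c"]) (metis add.commute diff_add_cancel)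
qed

lemma holomorphic_convex_primitive_at:
  assumes "convex S" "open S" "f holomorphic_on S"
  shows "\<exists>g. \<forall>z\<in>S. (g has_field_derivative f z) (at z)"
proof (rule holomorphic_convex_primitive'[OF assms])
  fix g assume "\<And>x. x \<in> S \<Longrightarrow> (g has_field_derivative f x) (at x within S)"
  then have "\<forall>z\<in>S. (g has_field_derivative f z) (at z)"
    using assms(2) at_within_open by metis
  then show ?thesis by (rule exI[of _ g])
qed

text \<open>Working on a convex \<open>D\<close> gives a primitive at once, with no appeal to the
  topology of \<Omega>. The formula for the derivative of \<open>F\<close> is what later links
  \<open>grad_norm u\<close> to the modulus of \<open>deriv h\<close>.\<close>

lemma harmonic_pullback_completion:
  assumes u: "harmonic_on \<Omega> u" and D: "open D" "convex D"
    and h: "h holomorphic_on D" "h ` D \<subseteq> \<Omega>"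
  obtains F where "F holomorphic_on D" "\<And>z. z \<in> D \<Longrightarrow> Re (F z) = u (h z)"
    "\<And>z. z \<in> D \<Longrightarrow> (F has_field_derivative cgrad u (h z) * deriv h z) (at z)"
proof (cases "D = {}")
  case True
  show ?thesis by (rule that[of "\<lambda>_. 0"]) (use True in auto)
next
  case False
  then obtain z0 where z0: "z0 \<in> D" by blast
  have hol: "(\<lambda>z. cgrad u (h z) * deriv h z) holomorphic_on D"
    using holomorphic_on_mult[OF holomorphic_on_compose_gen[OF h(1) cgrad_holomorphic[OF u] h(2)]
        holomorphic_deriv[OF h(1) D(1)]] by (simp add: o_def)
  obtain G where "\<forall>z\<in>D. (G has_field_derivative cgrad u (h z) * deriv h z) (at z)"
    using holomorphic_convex_primitive_at[OF D(2,1) hol] ..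
  then have G: "(G has_field_derivative cgrad u (h z) * deriv h z) (at z)" if "z \<in> D" for z
    using that by (rule bspec)
  have "((\<lambda>z. Re (G z) - u (h z)) has_derivative (\<lambda>_. 0)) (at z within D)" if z: "z \<in> D" for z
  proof -
    have hz: "(h has_derivative (\<lambda>t. deriv h z * t)) (at z)"
      using holomorphic_derivI[OF h(1) D(1) z] by (simp add: has_field_derivative_def)
    have "h z \<in> \<Omega>" using h(2) z by auto
    then have "u differentiable (at (h z))" using u by (simp add: harmonic_on_def)
    from diff_chain_at[OF hz has_derivative_cgrad[OF this]]
    have 1: "((\<lambda>z. u (h z)) has_derivative (\<lambda>t. Re (cgrad u (h z) * (deriv h z * t)))) (at z)"
      by (simp add: o_def)
    have "(G has_derivative (\<lambda>t. cgrad u (h z) * deriv h z * t)) (at z)"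
      using G[OF z] by (simp add: has_field_derivative_def)
    then have "((\<lambda>z. Re (G z) - u (h z)) has_derivative 
       (\<lambda>t. Re (cgrad u (h z) * deriv h z * t) - Re (cgrad u (h z) * (deriv h z * t)))) (at z)"
      by (intro has_derivative_diff has_derivative_Re 1)
    then have "((\<lambda>z. Re (G z) - u (h z)) has_derivative (\<lambda>t. 0)) (at z)"
      by (simp add: mult.assoc)
    then show ?thesis by (rule has_derivative_at_withinI)
  qed
  then have "\<exists>c. \<forall>z\<in>D. Re (G z) - u (h z) = c" 
    by (rule has_derivative_zero_constant[OF D(2)])
  then obtain c where c: "\<And>z. z \<in> D \<Longrightarrow> Re (G z) - u (h z) = c" by blast
  show ?thesis
  proof (rule that[of "\<lambda>z. G z - of_real c"])
    show "((\<lambda>z. G z - of_real c) has_field_derivative cgrad u (h z) * deriv h z) (at z)" if "z \<in> D" for z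
      using DERIV_diff[OF G[OF that] DERIV_const[of "of_real c"]] by simp
    then show "(\<lambda>z. G z - of_real c) holomorphic_on D" unfolding holomorphic_on_open[OF D(1)] by blast
    show "Re (G z - of_real c) = u (h z)" if "z \<in> D" for z using c[OF that] by simp
  qed
qed

section \<open>Positive harmonic functions vanishing off two boundary points\<close>

lemma Cauchy_formula_circle_average:
  assumes F: "F holomorphic_on cball 0 1" and z: "cmod z < 1"
  shows "((\<lambda>x. F (cis (2*pi*x)) * (cis (2*pi*x) / (cis (2*pi*x) - z))) has_integral F z) {0..1}"
proof -
  have e: "circlepath 0 1 x = cis (2*pi*x)" "exp (2 * of_real pi * \<i> * of_real x) = cis (2*pi*x)" for x
    by (simp_all add: circlepath cis_conv_exp mult_ac)
  have "((\<lambda>u. F u / (u - z)) has_contour_integral (2 * of_real pi * \<i> * F z)) (circlepath 0 1)"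
    using Cauchy_integral_circlepath_simple[OF F, of z] z by simp
  then have "((\<lambda>x. F (cis (2*pi*x)) / (cis (2*pi*x) - z) * (2 * of_real pi * \<i> * cis (2*pi*x))) has_integral (2 * of_real pi * \<i> * F z)) {0..1}"
    unfolding has_contour_integral vector_derivative_circlepath e by (simp add: mult_ac)
  from has_integral_mult_right[OF this, of "1 / (2 * of_real pi * \<i>)"] show ?thesis
    by (simp add: field_simps)
qed

text \<open>Cauchy's formula for \<open>F w / (1 - cnj z * w)\<close> at the origin, conjugated,
  yields \<open>cnj (F 0)\<close> as an average of \<open>cnj F\<close> against the same kernel that
  reproduces \<open>F z\<close>, because \<open>w * cnj w = 1\<close> on the circle. Adding the two
  leaves only the real part of \<open>F\<close> under the integral.\<close>

lemma Schwarz_formula_circle_average: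
  assumes F: "F holomorphic_on cball 0 1" and z: "cmod z < 1"
  shows "((\<lambda>x. of_real (Re (F (cis (2*pi*x)))) * (2 * cis (2*pi*x) / (cis (2*pi*x) - z))) has_integral (F z + cnj (F 0))) {0..1}"
proof -
  have nz: "1 - cnj z * w \<noteq> 0" if "cmod w \<le> 1" for w
  proof
    assume "1 - cnj z * w = 0"
    then have "cnj z * w = 1" by simp
    then have "cmod z * cmod w = 1" by (metis complex_mod_cnj norm_mult norm_one)
    moreover have "cmod z * cmod w \<le> cmod z * 1" using that by (intro mult_left_mono) auto
    ultimately show False using z by simp
  qed
  have "(\<lambda>w. F w / (1 - cnj z * w)) holomorphic_on cball 0 1"
    using nz by (intro holomorphic_intros F) auto
  from Cauchy_formula_circle_average[OF this, of 0]
  have "((\<lambda>x. F (cis (2*pi*x)) / (1 - cnj z * cis (2*pi*x))) has_integral F 0) {0..1}"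
    by simp
  then have "((\<lambda>x. cnj (F (cis (2*pi*x)) / (1 - cnj z * cis (2*pi*x)))) has_integral cnj (F 0)) {0..1}"
    by (subst (asm) has_integral_cnj[symmetric]) (simp add: o_def)
  also have "(\<lambda>x. cnj (F (cis (2*pi*x)) / (1 - cnj z * cis (2*pi*x)))) = 
    (\<lambda>x. cnj (F (cis (2*pi*x))) * (cis (2*pi*x) / (cis (2*pi*x) - z)))"
  proof
    fix x :: real
    have "cis (2*pi*x) * (1 - z * cnj (cis (2*pi*x))) = cis (2*pi*x) - z"
      by (simp add: algebra_simps cis_mult cis_cnj)
    moreover have "1 - z * cnj (cis (2*pi*x)) \<noteq> 0" 
      using nz[of "cis (2*pi*x)"] by (metis complex_cnj_cnj complex_cnj_diff complex_cnj_mult complex_cnj_one complex_cnj_zero norm_cis order_refl)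
    ultimately have "1 / (1 - z * cnj (cis (2*pi*x))) = cis (2*pi*x) / (cis (2*pi*x) - z)"
      by (metis cis_neq_zero mult.right_neutral mult_divide_mult_cancel_left)
    then show "cnj (F (cis (2*pi*x)) / (1 - cnj z * cis (2*pi*x))) = cnj (F (cis (2*pi*x))) * (cis (2*pi*x) / (cis (2*pi*x) - z))"
      by (metis (no_types) complex_cnj_cnj complex_cnj_diff complex_cnj_divide complex_cnj_mult complex_cnj_one mult.right_neutral times_divide_eq_right)
  qed
  finally have "((\<lambda>x. cnj (F (cis (2*pi*x))) * (cis (2*pi*x) / (cis (2*pi*x) - z))) has_integral cnj (F 0)) {0..1}" .
  from has_integral_add[OF Cauchy_formula_circle_average[OF F z] this]
  have "((\<lambda>x. (F (cis (2*pi*x)) + cnj (F (cis (2*pi*x)))) * (cis (2*pi*x) / (cis (2*pi*x) - z))) has_integral (F z + cnj (F 0))) {0..1}"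
    by (simp only: distrib_right)
  then show ?thesis by (simp add: complex_add_cnj mult_ac)
qed

locale two_point_boundary =
  fixes F :: "complex \<Rightarrow> complex" and a1 a2 :: complex
  assumes F: "F holomorphic_on ball 0 1" 
    and pos: "\<And>z. cmod z < 1 \<Longrightarrow> Re (F z) \<ge> 0"
    and a: "cmod a1 = 1" "cmod a2 = 1" "a1 \<noteq> a2"
    and bd: "\<And>\<zeta>. cmod \<zeta> = 1 \<Longrightarrow> \<zeta> \<noteq> a1 \<Longrightarrow> \<zeta> \<noteq> a2 \<Longrightarrow> ((\<lambda>z. Re (F z)) \<longlongrightarrow> 0) (at \<zeta> within ball 0 1)"
begin

definition r :: "nat \<Rightarrow> real" where "r n = 1 - 1 / real (n + 2)"

lemma r: "0 < r n" "r n < 1" and r_lim: "r \<longlonglongrightarrow> 1"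
proof -
  show "0 < r n" "r n < 1" by (auto simp: r_def)
  show "r \<longlonglongrightarrow> 1" unfolding r_def by real_asymp
qed

lemma Fr: "(\<lambda>z. F (of_real (r n) * z)) holomorphic_on cball 0 1"
proof -
  have "(F \<circ> (\<lambda>z. of_real (r n) * z)) holomorphic_on cball 0 1"
  proof (rule holomorphic_on_compose_gen[OF _ F])
    show "(\<lambda>z. of_real (r n) * z) ` cball 0 1 \<subseteq> ball (0::complex) 1"
    proof clarsimp
      fix z :: complex assume "cmod z \<le> 1"
      then have "r n * cmod z \<le> r n * 1" using r[of n] by (intro mult_left_mono) auto
      then have "r n * cmod z < 1" using r[of n] by linarith
      then show "cmod (of_real (r n) * z) < 1" using r[of n] by (simp add: norm_mult)
    qed
  qed (intro holomorphic_intros)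
  then show ?thesis by (simp add: o_def)
qed

text \<open>These are densities on the circle, parametrized by turns rather than radians, so that
  the mean value property gives each of them total mass \<open>Re (F 0)\<close>.\<close>

definition U :: "nat \<Rightarrow> real \<Rightarrow> real" where "U n x = Re (F (of_real (r n) * cis (2*pi*x)))"

lemma cmod_r_cis: "cmod \<zeta> = 1 \<Longrightarrow> cmod (of_real (r n) * \<zeta>) < 1"
  using r[of n] by (simp add: norm_mult)

lemma U_nonneg: "U n x \<ge> 0"
  unfolding U_def by (intro pos cmod_r_cis) simp

lemma continuous_U: "continuous_on {0..1} (U n)"
proof -
  have "continuous_on (cball 0 1) (\<lambda>z. F (of_real (r n) * z))" 
    using Fr holomorphic_on_imp_continuous_on by blast
  then have "continuous_on {0..1} (\<lambda>x. F (of_real (r n) * cis (2*pi*x)))"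
    by (rule continuous_on_compose2) (auto intro!: continuous_intros)
  then show ?thesis unfolding U_def by (rule continuous_on_Re)
qed

lemma integral_U: "integral {0..1} (U n) = Re (F 0)"
proof -
  have "((\<lambda>x. F (of_real (r n) * cis (2*pi*x))) has_integral F 0) {0..1}"
    using Cauchy_formula_circle_average[OF Fr[of n], of 0] by simp
  then have "(U n has_integral Re (F 0)) {0..1}"
    unfolding U_def by (rule has_integral_Re)
  then show ?thesis by (rule integral_unique)
qed

text \<open>Near \<open>a1\<close> and \<open>a2\<close> the densities may be unbounded, but \<phi>
  is small there and the term proportional to the density absorbs the product. Elsewhere the density
  itself becomes small, uniformly by compactness: violating points would accumulate at some
  \<open>l\<close> with \<open>cmod (\<phi> l)\<close> at least \<epsilon>, hence away from both
  exceptional points, where the boundary value is 0.\<close>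

lemma eventually_kernel_small:
  assumes \<phi>: "continuous_on (sphere 0 1) \<phi>" "\<phi> a1 = (0::complex)" "\<phi> a2 = 0" and \<epsilon>: "\<epsilon> > 0"
  shows "\<forall>\<^sub>F n in sequentially. \<forall>\<zeta>. cmod \<zeta> = 1 \<longrightarrow> 
     Re (F (of_real (r n) * \<zeta>)) * cmod (\<phi> \<zeta>) \<le> \<epsilon> * Re (F (of_real (r n) * \<zeta>)) + \<epsilon>"
proof (rule ccontr)
  let ?V = "\<lambda>n \<zeta>. Re (F (of_real (r n) * \<zeta>))"
  assume "\<not> ?thesis"
  then obtain f :: "nat \<Rightarrow> nat" where f: "strict_mono f" 
    and "\<And>n. \<not> (\<forall>\<zeta>. cmod \<zeta> = 1 \<longrightarrow> ?V (f n) \<zeta> * cmod (\<phi> \<zeta>) \<le> \<epsilon> * ?V (f n) \<zeta> + \<epsilon>)"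
    using not_eventually_sequentiallyD by blast
  then have "\<exists>\<zeta>. cmod \<zeta> = 1 \<and> ?V (f n) \<zeta> * cmod (\<phi> \<zeta>) > \<epsilon> * ?V (f n) \<zeta> + \<epsilon>" for n
    by (meson linorder_not_le)
  then obtain \<zeta> where \<zeta>: "\<And>n. cmod (\<zeta> n) = 1" 
    and big: "\<And>n. ?V (f n) (\<zeta> n) * cmod (\<phi> (\<zeta> n)) > \<epsilon> * ?V (f n) (\<zeta> n) + \<epsilon>" by metis
  have "\<forall>n. \<zeta> n \<in> sphere 0 1" using \<zeta> by simp
  then obtain l g where l: "l \<in> sphere 0 1" and g: "strict_mono g" and lim: "(\<zeta> \<circ> g) \<longlonglongrightarrow> l"
    using compact_sphere[of "0::complex" 1] unfolding compact_def by meson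
  have V0: "?V n (\<zeta> m) \<ge> 0" for n m by (intro pos cmod_r_cis \<zeta>)
  have phibig: "cmod (\<phi> (\<zeta> n)) \<ge> \<epsilon>" for n
  proof (rule ccontr)
    assume "\<not> ?thesis"
    then have "?V (f n) (\<zeta> n) * cmod (\<phi> (\<zeta> n)) \<le> ?V (f n) (\<zeta> n) * \<epsilon>"
      by (intro mult_left_mono V0) auto
    with big[of n] \<epsilon> show False by (simp add: mult.commute)
  qed
  have phil: "(\<lambda>n. cmod (\<phi> (\<zeta> (g n)))) \<longlonglongrightarrow> cmod (\<phi> l)"
  proof (intro tendsto_norm continuous_on_tendsto_compose[OF \<phi>(1)])
    show "(\<lambda>n. \<zeta> (g n)) \<longlonglongrightarrow> l" using lim by (simp add: o_def)
  qed (use l \<zeta> in auto)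
  have "\<epsilon> \<le> cmod (\<phi> l)" 
    by (rule LIMSEQ_le_const[OF phil]) (use phibig in auto)
  then have "l \<noteq> a1" "l \<noteq> a2" using \<phi> \<epsilon> by auto
  with l have L: "((\<lambda>z. Re (F z)) \<longlongrightarrow> 0) (at l within ball 0 1)" by (intro bd) auto
  have "(\<lambda>n. r (f (g n))) \<longlonglongrightarrow> 1"
    using LIMSEQ_subseq_LIMSEQ[OF LIMSEQ_subseq_LIMSEQ[OF r_lim f] g] by (simp add: o_def)
  then have "(\<lambda>n. of_real (r (f (g n))) * \<zeta> (g n)) \<longlonglongrightarrow> of_real 1 * l"
    using lim by (intro tendsto_mult tendsto_of_real) (auto simp: o_def)
  moreover have "of_real (r (f (g n))) * \<zeta> (g n) \<in> ball 0 1" for n using cmod_r_cis[OF \<zeta>] by simp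
  moreover have "of_real (r (f (g n))) * \<zeta> (g n) \<noteq> l" for n using cmod_r_cis[OF \<zeta>, of "f (g n)" "g n"] l by auto
  ultimately have "filterlim (\<lambda>n. of_real (r (f (g n))) * \<zeta> (g n)) (at l within ball 0 1) sequentially"
    by (simp add: filterlim_at)
  from filterlim_compose[OF L this]
  have "(\<lambda>n. ?V (f (g n)) (\<zeta> (g n))) \<longlonglongrightarrow> 0" .
  from tendsto_mult[OF this phil]
  have "(\<lambda>n. ?V (f (g n)) (\<zeta> (g n)) * cmod (\<phi> (\<zeta> (g n)))) \<longlonglongrightarrow> 0" by simp
  moreover have "\<epsilon> \<le> ?V (f (g n)) (\<zeta> (g n)) * cmod (\<phi> (\<zeta> (g n)))" for n
    using big[of "g n"] mult_nonneg_nonneg[OF less_imp_le[OF \<epsilon>] V0[of "f (g n)" "g n"]] by linarith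
  ultimately have "\<epsilon> \<le> 0" by (intro LIMSEQ_le_const) auto
  with \<epsilon> show False by simp
qed

lemma continuous_on_cis_arg:
  assumes "continuous_on (sphere 0 1) (\<phi> :: complex \<Rightarrow> complex)"
  shows "continuous_on {0..1} (\<lambda>x. \<phi> (cis (2*pi*x)))"
  by (rule continuous_on_compose2[OF assms]) (auto intro!: continuous_intros)

lemma integral_kernel_tendsto_0:
  assumes \<phi>: "continuous_on (sphere 0 1) \<phi>" "\<phi> a1 = (0::complex)" "\<phi> a2 = 0"
  shows "(\<lambda>n. integral {0..1} (\<lambda>x. of_real (U n x) * \<phi> (cis (2*pi*x)))) \<longlonglongrightarrow> 0"
proof (rule LIMSEQ_I)
  fix \<epsilon> :: real assume \<epsilon>: "\<epsilon> > 0"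
  \<comment> \<open>Integrating the pointwise bound gives \<delta> times
    \<open>Re (F 0) + 1\<close>; one unit more makes the final inequality strict.\<close>
  define K where "K = Re (F 0) + 2"
  have K: "K > 0" using pos[of 0] by (simp add: K_def)
  define \<delta> where "\<delta> = \<epsilon> / K"
  have \<delta>: "\<delta> > 0" using \<epsilon> K by (simp add: \<delta>_def)
  from eventually_kernel_small[OF \<phi> \<delta>] obtain N where N: "\<And>n \<zeta>. n \<ge> N \<Longrightarrow> cmod \<zeta> = 1 \<Longrightarrow> 
     Re (F (of_real (r n) * \<zeta>)) * cmod (\<phi> \<zeta>) \<le> \<delta> * Re (F (of_real (r n) * \<zeta>)) + \<delta>"
    unfolding eventually_sequentially by blast
  have "norm (integral {0..1} (\<lambda>x. of_real (U n x) * \<phi> (cis (2*pi*x))) - 0) < \<epsilon>" if n: "n \<ge> N" for n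
  proof -
    have "norm (integral {0..1} (\<lambda>x. of_real (U n x) * \<phi> (cis (2*pi*x)))) \<le> integral {0..1} (\<lambda>x. \<delta> * U n x + \<delta>)"
    proof (rule integral_norm_bound_integral)
      show "(\<lambda>x. of_real (U n x) * \<phi> (cis (2*pi*x))) integrable_on {0..1}"
        by (intro integrable_continuous_real continuous_on_mult continuous_on_of_real continuous_U continuous_on_cis_arg \<phi>)
      show "(\<lambda>x. \<delta> * U n x + \<delta>) integrable_on {0..1}"
        by (intro integrable_continuous_real continuous_intros continuous_U)
      show "norm (of_real (U n x) * \<phi> (cis (2*pi*x))) \<le> \<delta> * U n x + \<delta>" for x
        using N[OF n, of "cis (2*pi*x)"] U_nonneg[of n x] by (simp add: norm_mult U_def)
    qed
    also have "\<dots> = \<delta> * integral {0..1} (U n) + \<delta>"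
      using integrable_continuous_real[OF continuous_U[of n]] 
      by (subst integral_add) (auto intro!: integrable_continuous_real continuous_intros continuous_U)
    also have "\<dots> = \<delta> * (Re (F 0) + 1)" by (simp add: integral_U algebra_simps)
    also have "\<dots> < \<delta> * K" using \<delta> by (simp add: K_def)
    also have "\<dots> = \<epsilon>" using K by (simp add: \<delta>_def)
    finally show ?thesis by simp
  qed
  then show "\<exists>N. \<forall>n\<ge>N. norm (integral {0..1} (\<lambda>x. of_real (U n x) * \<phi> (cis (2*pi*x))) - 0) < \<epsilon>" by blast
qed

text \<open>\<open>W1\<close> equals 1 at \<open>a1\<close> and 0 at \<open>a2\<close>, and
  \<open>W2\<close> the reverse. Hence \<open>M1\<close> and \<open>M2\<close> approximate the
  masses that concentrate at the two points, and nonnegativity of the weights passes to the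
  limits.\<close>

definition W1 :: "complex \<Rightarrow> real" where "W1 \<zeta> = (cmod (\<zeta> - a2) / cmod (a1 - a2))\<^sup>2"
definition W2 :: "complex \<Rightarrow> real" where "W2 \<zeta> = (cmod (\<zeta> - a1) / cmod (a1 - a2))\<^sup>2"
definition M1 :: "nat \<Rightarrow> real" where "M1 n = integral {0..1} (\<lambda>x. U n x * W1 (cis (2*pi*x)))"
definition M2 :: "nat \<Rightarrow> real" where "M2 n = integral {0..1} (\<lambda>x. U n x * W2 (cis (2*pi*x)))"

lemma W_cont: "continuous_on {0..1} (\<lambda>x. W1 (cis (2*pi*x)))" "continuous_on {0..1} (\<lambda>x. W2 (cis (2*pi*x)))"
  unfolding W1_def W2_def using a(3) by (auto intro!: continuous_intros)

lemma W_le: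
  assumes "cmod \<zeta> = 1" 
  shows "W1 \<zeta> \<le> (2 / cmod (a1 - a2))\<^sup>2" "W2 \<zeta> \<le> (2 / cmod (a1 - a2))\<^sup>2"
  unfolding W1_def W2_def using assms a norm_triangle_ineq4[of \<zeta> a2] norm_triangle_ineq4[of \<zeta> a1]
  by (auto intro!: power_mono divide_right_mono)

lemma W_nonneg: "W1 \<zeta> \<ge> 0" "W2 \<zeta> \<ge> 0"
  by (simp_all add: W1_def W2_def)

lemma M_bound:
  shows "0 \<le> M1 n" "M1 n \<le> (2 / cmod (a1 - a2))\<^sup>2 * Re (F 0)" 
    and "0 \<le> M2 n" "M2 n \<le> (2 / cmod (a1 - a2))\<^sup>2 * Re (F 0)"
proof -
  let ?B = "(2 / cmod (a1 - a2))\<^sup>2"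
  have int: "(\<lambda>x. U n x * W1 (cis (2*pi*x))) integrable_on {0..1}" 
     "(\<lambda>x. U n x * W2 (cis (2*pi*x))) integrable_on {0..1}" "(\<lambda>x. ?B * U n x) integrable_on {0..1}"
    by (intro integrable_continuous_real continuous_intros continuous_U W_cont)+
  show "0 \<le> M1 n" "0 \<le> M2 n" unfolding M1_def M2_def
    by (auto intro!: integral_nonneg int mult_nonneg_nonneg U_nonneg W_nonneg)
  have "M1 n \<le> integral {0..1} (\<lambda>x. ?B * U n x)" unfolding M1_def
    by (intro integral_le int) (auto simp: mult.commute[of _ "U _ _"] intro!: mult_left_mono W_le U_nonneg)
  then show "M1 n \<le> ?B * Re (F 0)" by (simp add: integral_U)
  have "M2 n \<le> integral {0..1} (\<lambda>x. ?B * U n x)" unfolding M2_def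
    by (intro integral_le int) (auto simp: mult.commute[of _ "U _ _"] intro!: mult_left_mono W_le U_nonneg)
  then show "M2 n \<le> ?B * Re (F 0)" by (simp add: integral_U)
qed

text \<open>Convergence along a subsequence is enough, since the other side of the limiting
  identity, \<open>F z\<close>, does not depend on it; the subsequence is chosen once, before
  \<open>z\<close>.\<close>

lemma M_subseq:
  obtains m1 m2 f where "strict_mono f" "m1 \<ge> 0" "m2 \<ge> 0" "(\<lambda>n. M1 (f n)) \<longlonglongrightarrow> m1" "(\<lambda>n. M2 (f n)) \<longlonglongrightarrow> m2"
proof -
  let ?B = "(2 / cmod (a1 - a2))\<^sup>2 * Re (F 0)"
  have "compact ({0..?B} \<times> {0..?B})" by (intro compact_Times compact_Icc)
  moreover have "\<forall>n. (M1 n, M2 n) \<in> {0..?B} \<times> {0..?B}" using M_bound by simp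
  ultimately obtain l f where l: "l \<in> {0..?B} \<times> {0..?B}" and f: "strict_mono f" 
    and lim: "((\<lambda>n. (M1 n, M2 n)) \<circ> f) \<longlonglongrightarrow> l"
    unfolding compact_def by meson
  show ?thesis
    by (rule that[OF f, of "fst l" "snd l"]) 
      (use l tendsto_fst[OF lim] tendsto_snd[OF lim] in \<open>auto simp: o_def\<close>)
qed

text \<open>Interpolating the Cauchy kernel at \<open>a1\<close>, \<open>a2\<close> with the nonnegative weights \<open>W1\<close>, \<open>W2\<close>
  leaves a remainder that vanishes at both points, so its integral disappears in the limit.\<close>

theorem representation:
  obtains m1 m2 :: real where "m1 \<ge> 0" "m2 \<ge> 0" 
    "\<And>z. cmod z < 1 \<Longrightarrow> F z = of_real m1 * ((a1 + z) / (a1 - z)) + of_real m2 * ((a2 + z) / (a2 - z)) + \<i> * of_real (Im (F 0))"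
proof -
  obtain m1 m2 f where f: "strict_mono f" and m: "m1 \<ge> 0" "m2 \<ge> 0" 
    and lim: "(\<lambda>n. M1 (f n)) \<longlonglongrightarrow> m1" "(\<lambda>n. M2 (f n)) \<longlonglongrightarrow> m2" by (rule M_subseq)
  have *: "F z + cnj (F 0) = of_real m1 * (2 * a1 / (a1 - z)) + of_real m2 * (2 * a2 / (a2 - z))" if z: "cmod z < 1" for z
  proof -
    define k where "k \<zeta> = 2 * \<zeta> / (\<zeta> - z)" for \<zeta>
    define \<phi> where "\<phi> \<zeta> = k \<zeta> - of_real (W1 \<zeta>) * k a1 - of_real (W2 \<zeta>) * k a2" for \<zeta>
    have kc: "continuous_on (sphere 0 1) k"
      unfolding k_def using z by (intro continuous_intros) auto
    have "continuous_on (sphere 0 1) \<phi>"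
      unfolding \<phi>_def W1_def W2_def using a by (intro continuous_intros kc) auto
    moreover have "\<phi> a1 = 0" "\<phi> a2 = 0"
      using a by (auto simp: \<phi>_def W1_def W2_def norm_minus_commute)
    ultimately have "(\<lambda>n. integral {0..1} (\<lambda>x. of_real (U n x) * \<phi> (cis (2*pi*x)))) \<longlonglongrightarrow> 0"
      by (rule integral_kernel_tendsto_0)
    moreover have "integral {0..1} (\<lambda>x. of_real (U n x) * \<phi> (cis (2*pi*x))) = 
       F (of_real (r n) * z) + cnj (F 0) - of_real (M1 n) * k a1 - of_real (M2 n) * k a2" for n
    proof -
      have 0: "((\<lambda>x. of_real (U n x) * k (cis (2*pi*x))) has_integral (F (of_real (r n) * z) + cnj (F 0))) {0..1}"
        using Schwarz_formula_circle_average[OF Fr[of n] z] by (simp add: U_def k_def)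
      have 1: "((\<lambda>x. of_real (U n x * W1 (cis (2*pi*x))) * k a1) has_integral (of_real (M1 n) * k a1)) {0..1}"
        unfolding M1_def
        by (intro has_integral_mult_left has_integral_of_real integrable_integral integrable_continuous_real continuous_intros continuous_U W_cont)
      have 2: "((\<lambda>x. of_real (U n x * W2 (cis (2*pi*x))) * k a2) has_integral (of_real (M2 n) * k a2)) {0..1}"
        unfolding M2_def
        by (intro has_integral_mult_left has_integral_of_real integrable_integral integrable_continuous_real continuous_intros continuous_U W_cont)
      from has_integral_diff[OF has_integral_diff[OF 0 1] 2] show ?thesis
        by (intro integral_unique) (simp add: \<phi>_def algebra_simps)
    qed
    ultimately have "(\<lambda>n. F (of_real (r n) * z) + cnj (F 0) - of_real (M1 n) * k a1 - of_real (M2 n) * k a2) \<longlonglongrightarrow> 0"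
      by simp
    from LIMSEQ_subseq_LIMSEQ[OF this f]
    have A: "(\<lambda>n. F (of_real (r (f n)) * z) + cnj (F 0) - of_real (M1 (f n)) * k a1 - of_real (M2 (f n)) * k a2) \<longlonglongrightarrow> 0"
      by (simp add: o_def)
    have "(\<lambda>n. of_real (r (f n)) * z) \<longlonglongrightarrow> of_real 1 * z"
      using LIMSEQ_subseq_LIMSEQ[OF r_lim f] by (intro tendsto_mult tendsto_of_real) (auto simp: o_def)
    moreover have "isCont F z"
      using F z by (meson continuous_on_eq_continuous_at holomorphic_on_imp_continuous_on mem_ball_0 open_ball)
    ultimately have "(\<lambda>n. F (of_real (r (f n)) * z)) \<longlonglongrightarrow> F z"
      by (intro isCont_tendsto_compose[of z F]) auto
    then have "(\<lambda>n. F (of_real (r (f n)) * z) + cnj (F 0) - of_real (M1 (f n)) * k a1 - of_real (M2 (f n)) * k a2) 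
       \<longlonglongrightarrow> F z + cnj (F 0) - of_real m1 * k a1 - of_real m2 * k a2"
      by (intro tendsto_intros lim)
    with A have "0 = F z + cnj (F 0) - of_real m1 * k a1 - of_real m2 * k a2" by (rule LIMSEQ_unique)
    then show ?thesis by (simp add: k_def algebra_simps)
  qed
  have a0: "a1 \<noteq> 0" "a2 \<noteq> 0" using a by auto
  \<comment> \<open>The origin identifies \<open>m1 + m2\<close> as the real part of
    \<open>F 0\<close>. This removes \<open>cnj (F 0)\<close> from the formula and turns each kernel
    \<open>2 * a / (a - z)\<close> into \<open>(a + z) / (a - z)\<close>.\<close>
  from *[of 0] a0 have F0: "F 0 + cnj (F 0) = 2 * of_real (m1 + m2)" by simp
  from arg_cong[OF this, of Re] have Re0: "Re (F 0) = m1 + m2" by simp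
  have "F z = of_real m1 * ((a1 + z) / (a1 - z)) + of_real m2 * ((a2 + z) / (a2 - z)) + \<i> * of_real (Im (F 0))"
    if z: "cmod z < 1" for z
  proof -
    have nz: "a1 - z \<noteq> 0" "a2 - z \<noteq> 0" using z a by auto
    have e: "2 * a1 / (a1 - z) = (a1 + z) / (a1 - z) + 1" "2 * a2 / (a2 - z) = (a2 + z) / (a2 - z) + 1"
      using nz by (simp_all add: field_simps)
    have "cnj (F 0) = of_real (m1 + m2) - \<i> * of_real (Im (F 0))"
      using Re0 by (simp add: complex_eq_iff)
    with *[OF z] show ?thesis unfolding e by (simp add: algebra_simps)
  qed
  with m that show ?thesis by blast
qed

end

section \<open>Boundary behaviour of a conformal map with rational derivative\<close>

lemma infinite_circle_near:
  assumes "cmod \<zeta> = 1" "\<epsilon> > 0"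
  shows "infinite (sphere 0 1 \<inter> ball \<zeta> \<epsilon>)"
proof -
  have "1 \<in> sphere (0::complex) 1" "-1 \<in> sphere (0::complex) 1" "(1::complex) \<noteq> -1" by auto
  then have "sphere (0::complex) 1 \<noteq> {x}" for x by (metis singletonD)
  then have "\<zeta> islimpt sphere 0 1"
    using assms by (intro connected_imp_perfect connected_sphere) auto
  then show ?thesis using assms(2) by (simp add: islimpt_eq_infinite_ball)
qed

lemma infdist_ge:
  assumes "S \<noteq> {}" "ball x \<rho> \<inter> S = {}"
  shows "infdist x S \<ge> \<rho>"
  unfolding infdist_notempty[OF assms(1)]
  using assms by (intro cINF_greatest) (auto simp: disjoint_iff not_less)

locale rational_conformal_map =
  fixes \<Omega> :: "complex set" and h :: "complex \<Rightarrow> complex" and p q :: "complex poly"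
  assumes hol: "h holomorphic_on ball 0 1" and inj: "inj_on h (ball 0 1)"
    and img: "h ` ball 0 1 = \<Omega>" 
    and q0: "q \<noteq> 0"
    and deriv_h: "\<And>z. z \<in> ball 0 1 \<Longrightarrow> deriv h z = poly p z / poly q z"
begin

lemma open_image: "open \<Omega>"
  using open_mapping_thm3[OF hol _ inj] img by simp

text \<open>Injectivity makes the derivative nonzero. This excludes zeros of \<open>q\<close> as
  well as of \<open>p\<close>, since division by zero yields 0.\<close>

lemma poly_nz:
  assumes "cmod z < 1"
  shows "poly p z \<noteq> 0" "poly q z \<noteq> 0"
  using holomorphic_injective_imp_regular[OF hol _ inj, of z] deriv_h[of z] assms by auto

lemma p0: "p \<noteq> 0"
  using poly_nz(1)[of 0] by auto

lemma h_has_deriv: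
  assumes "cmod z < 1"
  shows "(h has_field_derivative poly p z / poly q z) (at z)"
  using holomorphic_derivI[OF hol _ , of z] deriv_h[of z] assms by simp

definition extends :: "complex \<Rightarrow> real \<Rightarrow> (complex \<Rightarrow> complex) \<Rightarrow> bool" where
  "extends \<zeta> e H \<longleftrightarrow> e > 0 \<and> (\<forall>z\<in>ball \<zeta> e. poly q z \<noteq> 0 \<and> (H has_field_derivative poly p z / poly q z) (at z)) \<and>
     (\<forall>z\<in>ball \<zeta> e \<inter> ball 0 1. h z = H z)"

text \<open>A primitive of \<open>p/q\<close> exists on a ball free of zeros of \<open>q\<close>.
  Its intersection with the disc is convex, so there the primitive differs from \<open>h\<close> by
  one constant.\<close>

lemma extension_exists:
  assumes "poly q \<zeta> \<noteq> 0"
  obtains e H where "extends \<zeta> e H"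
proof -
  have "open {z. poly q z \<noteq> 0}" by (intro open_Collect_neq continuous_intros)
  moreover have "\<zeta> \<in> {z. poly q z \<noteq> 0}" using assms by simp
  ultimately obtain e where e: "e > 0" "ball \<zeta> e \<subseteq> {z. poly q z \<noteq> 0}"
    by (rule openE)
  have "(\<lambda>z. poly p z / poly q z) holomorphic_on ball \<zeta> e"
    using e by (intro holomorphic_intros) auto
  from holomorphic_convex_primitive_at[OF convex_ball open_ball this]
  obtain H where H: "\<forall>z\<in>ball \<zeta> e. (H has_field_derivative poly p z / poly q z) (at z)" ..
  have "((\<lambda>z. h z - H z) has_field_derivative 0) (at z within ball \<zeta> e \<inter> ball 0 1)" 
    if "z \<in> ball \<zeta> e \<inter> ball 0 1" for z
  proof -
    have "(h has_field_derivative poly p z / poly q z) (at z)" "(H has_field_derivative poly p z / poly q z) (at z)"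
      using h_has_deriv[of z] H that by auto
    from DERIV_diff[OF this] have "((\<lambda>z. h z - H z) has_field_derivative 0) (at z)" by simp
    then show ?thesis by (rule has_field_derivative_at_within)
  qed
  then have "\<exists>c. \<forall>z \<in> ball \<zeta> e \<inter> ball 0 1. h z - H z = c"
    by (intro has_field_derivative_zero_constant convex_Int convex_ball) auto
  then obtain c where c: "\<forall>z \<in> ball \<zeta> e \<inter> ball 0 1. h z - H z = c" ..
  have "extends \<zeta> e (\<lambda>z. H z + c)"
    unfolding extends_def
  proof (intro conjI ballI)
    fix z assume z: "z \<in> ball \<zeta> e"
    then show "poly q z \<noteq> 0" using e by auto
    show "((\<lambda>z. H z + c) has_field_derivative poly p z / poly q z) (at z)"
      using DERIV_add[OF H[rule_format, OF z] DERIV_const[of c]] by simp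
  qed (use e c in \<open>auto simp: algebra_simps\<close>)
  then show ?thesis by (rule that)
qed

section \<open>Approach to the circle along radii\<close>

definition radial :: "complex \<Rightarrow> nat \<Rightarrow> complex" where
  "radial \<zeta> n = of_real (1 - 1 / real (n + 2)) * \<zeta>"

lemma radial:
  assumes "cmod \<zeta> = 1"
  shows "cmod (radial \<zeta> n) = 1 - 1 / real (n + 2)" "cmod (radial \<zeta> n) < 1"
    "cmod (radial \<zeta> n - \<zeta>) = 1 / real (n + 2)"
    "radial \<zeta> \<longlonglongrightarrow> \<zeta>"
proof -
  have "\<bar>1 - 1 / real (n + 2)\<bar> = 1 - 1 / real (n + 2)" by simp
  then show 1: "cmod (radial \<zeta> n) = 1 - 1 / real (n + 2)"
    unfolding radial_def norm_mult assms norm_of_real by simp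
  then show "cmod (radial \<zeta> n) < 1" by simp
  have "radial \<zeta> n - \<zeta> = - (of_real (1 / real (n + 2)) * \<zeta>)" by (simp add: radial_def algebra_simps)
  then have "cmod (radial \<zeta> n - \<zeta>) = cmod (of_real (1 / real (n + 2)) * \<zeta>)" by (metis norm_minus_cancel)
  then show "cmod (radial \<zeta> n - \<zeta>) = 1 / real (n + 2)" unfolding norm_mult assms norm_of_real by simp
  have "(\<lambda>n. 1 - 1 / real (n + 2)) \<longlonglongrightarrow> 1" by real_asymp
  from tendsto_mult[OF tendsto_of_real[OF this, where 'a = complex] tendsto_const[of \<zeta>]]
  show "radial \<zeta> \<longlonglongrightarrow> \<zeta>" by (simp add: radial_def[abs_def])
qed

lemma extends_isCont: "extends \<zeta> e H \<Longrightarrow> z \<in> ball \<zeta> e \<Longrightarrow> isCont H z"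
  unfolding extends_def using DERIV_isCont[of H "poly p z / poly q z" z] by simp

lemma extends_tendsto:
  assumes H: "extends \<zeta> e H" and z: "z \<in> ball \<zeta> e"
  shows "(h \<longlongrightarrow> H z) (at z within ball 0 1)"
proof -
  have "(H \<longlongrightarrow> H z) (at z within ball 0 1)"
    using extends_isCont[OF H z] unfolding isCont_def by (rule Lim_at_imp_Lim_at_within)
  moreover have "\<forall>\<^sub>F x in at z within ball 0 1. H x = h x"
    unfolding eventually_at_topological
    using H z by (intro exI[of _ "ball \<zeta> e"]) (auto simp: extends_def)
  ultimately show ?thesis by (rule Lim_transform_eventually)
qed

lemma radial_filterlim:
  assumes "cmod \<zeta> = 1"
  shows "filterlim (radial \<zeta>) (at \<zeta> within ball 0 1) sequentially"
proof -
  have "radial \<zeta> n \<noteq> \<zeta>" for n using radial(2)[OF assms, of n] assms by auto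
  then show ?thesis using radial[OF assms] by (simp add: filterlim_at)
qed

text \<open>If the boundary value lay in \<Omega>, the continuous inverse of \<open>h\<close> would
  carry the radial images to a limit inside the disc, although the radial points converge to a point
  of modulus 1.\<close>

lemma extends_frontier:
  assumes H: "extends \<zeta> e H" and z: "z \<in> ball \<zeta> e" "cmod z = 1"
  shows "H z \<in> frontier \<Omega>" "H z \<notin> \<Omega>"
proof -
  have lim: "(\<lambda>n. h (radial z n)) \<longlonglongrightarrow> H z"
    using filterlim_compose[OF extends_tendsto[OF H z(1)] radial_filterlim[OF z(2)]] .
  have in\<Omega>: "h (radial z n) \<in> \<Omega>" for n using img radial(2)[OF z(2), of n] by auto
  show notin: "H z \<notin> \<Omega>"
  proof
    assume \<Omega>: "H z \<in> \<Omega>"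
    obtain g where g: "g holomorphic_on h ` ball 0 1" "\<And>z. z \<in> ball 0 1 \<Longrightarrow> g (h z) = z"
      using holomorphic_has_inverse[OF hol open_ball inj] by metis
    have "isCont g (H z)"
      using g(1) open_image \<Omega> img by (metis continuous_on_eq_continuous_at holomorphic_on_imp_continuous_on)
    from isCont_tendsto_compose[OF this lim] have "(\<lambda>n. radial z n) \<longlonglongrightarrow> g (H z)"
      using g(2) radial(2)[OF z(2)] by simp
    then have "g (H z) = z" using radial(4)[OF z(2)] LIMSEQ_unique by blast
    moreover obtain w where "w \<in> ball 0 1" "H z = h w" using \<Omega> img by blast
    ultimately show False using g(2)[of w] z(2) by simp
  qed
  have "H z \<in> closure \<Omega>"
    unfolding closure_sequential using in\<Omega> lim by (intro exI[of _ "\<lambda>n. h (radial z n)"]) simp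
  then show "H z \<in> frontier \<Omega>"
    using notin open_image by (simp add: frontier_def interior_open)
qed

lemma boundary_value_zero:
  assumes u: "\<And>\<zeta>. \<zeta> \<in> frontier \<Omega> \<Longrightarrow> (u \<longlongrightarrow> (0::real)) (at \<zeta> within \<Omega>)" 
    and \<zeta>: "cmod \<zeta> = 1" "poly q \<zeta> \<noteq> 0"
  shows "((\<lambda>z. u (h z)) \<longlongrightarrow> 0) (at \<zeta> within ball 0 1)"
proof -
  obtain e H where H: "extends \<zeta> e H" using extension_exists[OF \<zeta>(2)] .
  then have z: "\<zeta> \<in> ball \<zeta> e" by (simp add: extends_def)
  have "\<forall>\<^sub>F x in at \<zeta> within ball 0 1. h x \<in> \<Omega> \<and> h x \<noteq> H \<zeta>"
    unfolding eventually_at_topological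
    by (intro exI[of _ UNIV]) (metis extends_frontier(2)[OF H z \<zeta>(1)] UNIV_I image_eqI img open_UNIV)
  then have "filterlim h (at (H \<zeta>) within \<Omega>) (at \<zeta> within ball 0 1)"
    using extends_tendsto[OF H z] by (simp add: filterlim_at)
  from filterlim_compose[OF u[OF extends_frontier(1)[OF H z \<zeta>(1)]] this] show ?thesis .
qed

text \<open>Bloch's covering lemma bounds the distance from \<open>h (r\<zeta>)\<close> to the boundary from below, without
  any knowledge of how \<open>\<Omega>\<close> looks near the boundary point.\<close>

lemma radial_nontangential:
  assumes H: "extends \<zeta> e H" and \<zeta>: "cmod \<zeta> = 1" "poly p \<zeta> \<noteq> 0"
  obtains M where "M > 1" "\<forall>\<^sub>F n in sequentially. h (radial \<zeta> n) \<in> nt_region \<Omega> M (H \<zeta>)"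
proof -
  let ?d = "\<lambda>z. poly p z / poly q z"
  define A where "A = cmod (?d \<zeta>)"
  have e: "e > 0" and qz: "\<And>z. z \<in> ball \<zeta> e \<Longrightarrow> poly q z \<noteq> 0" 
    and Hd: "\<And>z. z \<in> ball \<zeta> e \<Longrightarrow> (H has_field_derivative ?d z) (at z)"
    and hH: "\<And>z. z \<in> ball \<zeta> e \<Longrightarrow> cmod z < 1 \<Longrightarrow> h z = H z"
    using H by (auto simp: extends_def)
  have A: "A > 0" using \<zeta> qz[of \<zeta>] e by (simp add: A_def)
  have "isCont (\<lambda>z. cmod (?d z)) \<zeta>" using qz[of \<zeta>] e by (intro continuous_intros) auto
  moreover have "A / 4 > 0" using A by simp
  \<comment> \<open>The tolerance \<open>A / 4\<close> keeps the modulus of the derivative between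
    \<open>3 * A / 4\<close> and \<open>5 * A / 4\<close>; the ratio 5/3 respects the factor 2
    allowed by \<open>Bloch_lemma\<close>.\<close>
  ultimately obtain \<delta>0 where \<delta>0: "\<delta>0 > 0" "\<And>z. dist z \<zeta> < \<delta>0 \<Longrightarrow> \<bar>cmod (?d z) - A\<bar> < A / 4"
    unfolding continuous_at_eps_delta dist_real_def A_def by blast
  define \<delta> where "\<delta> = min \<delta>0 e"
  have \<delta>: "\<delta> > 0" "ball \<zeta> \<delta> \<subseteq> ball \<zeta> e" using e \<delta>0 by (auto simp: \<delta>_def)
  have dz: "cmod (?d z) \<le> 5 * A / 4" "3 * A / 4 \<le> cmod (?d z)" if "z \<in> ball \<zeta> \<delta>" for z
  proof -
    have "dist z \<zeta> < \<delta>0" using that by (simp add: \<delta>_def dist_commute)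
    from \<delta>0(2)[OF this] show "cmod (?d z) \<le> 5 * A / 4" "3 * A / 4 \<le> cmod (?d z)" by linarith+
  qed
  have "sqrt 2 < 3/2" by (rule real_less_lsqrt) (auto simp: power2_eq_square)
  \<comment> \<open>This is the constant of \<open>Bloch_lemma\<close>.\<close>
  define k where "k = 3 - 2 * sqrt 2"
  have k: "k > 0" using \<open>sqrt 2 < 3/2\<close> by (simp add: k_def)
  \<comment> \<open>At distance \<open>t\<close> from \<zeta>, the image is within
    \<open>5 * A * t / 4\<close> of \<open>H \<zeta>\<close> and at least
    \<open>3 * k * A * t / 8\<close> from the frontier. The quotient is \<open>10 / (3 * k)\<close>,
    and the summand 2 gives strictness and \<open>M > 1\<close>.\<close>
  define M where "M = 2 + 10 / (3 * k)"
  have M: "M > 1" using k by (simp add: M_def add_pos_pos)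
  \<comment> \<open>The covering lemma is applied on the ball of radius \<open>t/2\<close> about a
    point at distance \<open>t\<close> from \<zeta>, so everything stays within
    \<open>3/2 * t\<close> of \<zeta>.\<close>
  have "\<forall>\<^sub>F n in sequentially. 3 / 2 * (1 / real (n + 2)) < \<delta>"
    using \<delta>(1) by real_asymp
  then have "\<forall>\<^sub>F n in sequentially. h (radial \<zeta> n) \<in> nt_region \<Omega> M (H \<zeta>)"
  proof eventually_elim
    case (elim n)
    let ?z = "radial \<zeta> n"
    define t where "t = 1 / real (n + 2)"
    have t: "t > 0" "3 / 2 * t < \<delta>" using elim by (auto simp: t_def)
    have z: "cmod ?z = 1 - t" "cmod ?z < 1" "cmod (?z - \<zeta>) = t" 
      using radial(1-3)[OF \<zeta>(1), of n] by (auto simp: t_def)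
    have zb: "?z \<in> ball \<zeta> \<delta>" using z t by (simp add: dist_norm norm_minus_commute)
    have "cmod (H ?z - H \<zeta>) \<le> 5 * A / 4 * cmod (?z - \<zeta>)"
    proof (rule field_differentiable_bound[OF convex_ball[of \<zeta> \<delta>], where f' = ?d])
      show "(H has_field_derivative ?d w) (at w within ball \<zeta> \<delta>)" if "w \<in> ball \<zeta> \<delta>" for w
        using that \<delta>(2) by (intro has_field_derivative_at_within[OF Hd]) auto
    qed (use zb \<delta> dz in auto)
    then have dist: "dist (h ?z) (H \<zeta>) \<le> 5 * A / 4 * t" 
      using hH[of ?z] zb \<delta> z by (auto simp: dist_norm)
    have sub: "w \<in> ball 0 1 \<and> w \<in> ball \<zeta> \<delta>" if "w \<in> cball ?z (t/2)" for w
    proof -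
      have "cmod w \<le> cmod ?z + t/2" using norm_triangle_sub[where x = w and y = ?z] that 
        by (simp add: dist_norm norm_minus_commute)
      moreover have "dist \<zeta> w \<le> t + t/2" using dist_triangle[where x = \<zeta> and z = w and y = ?z] that z(3)
        by (simp add: dist_norm norm_minus_commute)
      ultimately show ?thesis using z t by simp
    qed
    have "ball (h ?z) (k * (t/2) * norm (deriv h ?z)) \<subseteq> h ` ball ?z (t/2)"
      unfolding k_def
    proof (rule Bloch_lemma)
      show "h holomorphic_on cball ?z (t/2)" using hol by (rule holomorphic_on_subset) (use sub in auto)
      show "norm (deriv h w) \<le> 2 * norm (deriv h ?z)" if w: "w \<in> ball ?z (t/2)" for w
      proof -
        have "w \<in> ball 0 1" "w \<in> ball \<zeta> \<delta>" using sub[of w] w by auto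
        then show ?thesis using deriv_h[of w] deriv_h[of ?z] z(2) dz(1)[of w] dz(2)[OF zb] A by simp
      qed
    qed (use t in simp)
    also have "\<dots> \<subseteq> \<Omega>" unfolding img[symmetric] using sub by (intro image_mono) auto
    finally have "ball (h ?z) (k * (t/2) * norm (deriv h ?z)) \<inter> frontier \<Omega> = {}"
      using open_image by (auto simp: frontier_def interior_open)
    then have "k * (t/2) * norm (deriv h ?z) \<le> infdist (h ?z) (frontier \<Omega>)"
      using extends_frontier(1)[OF H _ \<zeta>(1)] e by (intro infdist_ge) auto
    moreover have "k * (t/2) * (3 * A / 4) \<le> k * (t/2) * norm (deriv h ?z)"
      using dz(2)[OF zb] deriv_h[of ?z] z k t by (intro mult_left_mono) auto
    ultimately have inf: "k * (t/2) * (3 * A / 4) \<le> infdist (h ?z) (frontier \<Omega>)" by linarith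
    have "5 * A / 4 * t = 10 / (3 * k) * (k * (t/2) * (3 * A / 4))" using k by (simp add: field_simps)
    also have "\<dots> < M * (k * (t/2) * (3 * A / 4))"
      using k t A by (intro mult_strict_right_mono) (auto simp: M_def)
    also have "\<dots> \<le> M * infdist (h ?z) (frontier \<Omega>)" using inf M by (intro mult_left_mono) auto
    finally have "dist (h ?z) (H \<zeta>) < M * infdist (h ?z) (frontier \<Omega>)" using dist by linarith
    then show ?case using img z(2) by (auto simp: nt_region_def)
  qed
  then show ?thesis using M that by blast
qed

lemma normal_derivative_radial:
  assumes H: "extends \<zeta> e H" and \<zeta>: "cmod \<zeta> = 1" "poly p \<zeta> \<noteq> 0"
    and nd: "normal_derivative_is \<Omega> u (H \<zeta>) c"
  shows "(\<lambda>n. grad_norm u (h (radial \<zeta> n))) \<longlonglongrightarrow> c"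
proof -
  obtain M where M: "M > 1" "\<forall>\<^sub>F n in sequentially. h (radial \<zeta> n) \<in> nt_region \<Omega> M (H \<zeta>)"
    by (rule radial_nontangential[OF H \<zeta>])
  have z: "\<zeta> \<in> ball \<zeta> e" using H by (simp add: extends_def)
  have "(\<lambda>n. h (radial \<zeta> n)) \<longlonglongrightarrow> H \<zeta>"
    using filterlim_compose[OF extends_tendsto[OF H z] radial_filterlim[OF \<zeta>(1)]] .
  moreover have "\<forall>\<^sub>F n in sequentially. h (radial \<zeta> n) \<in> nt_region \<Omega> M (H \<zeta>) \<and> h (radial \<zeta> n) \<noteq> H \<zeta>"
    using M(2) extends_frontier(2)[OF H z \<zeta>(1)] by (auto elim!: eventually_mono simp: nt_region_def)
  ultimately have "filterlim (\<lambda>n. h (radial \<zeta> n)) (at (H \<zeta>) within nt_region \<Omega> M (H \<zeta>)) sequentially"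
    by (simp add: filterlim_at)
  moreover have "(grad_norm u \<longlongrightarrow> c) (at (H \<zeta>) within nt_region \<Omega> M (H \<zeta>))"
    using nd M(1) by (simp add: normal_derivative_is_def)
  ultimately show ?thesis by (rule filterlim_compose[rotated])
qed


text \<open>Since \<open>p\<close> does not vanish at \<zeta>, the extension is locally injective. A
  short arc then has a connected image with two distinct points, and such a set is not contained in
  a null set.\<close>

lemma nonnull_circle_point_near:
  assumes N: "h1_null N" and H: "extends \<zeta> e H" and \<zeta>: "cmod \<zeta> = 1" "poly p \<zeta> \<noteq> 0" and \<epsilon>: "\<epsilon> > 0"
  obtains \<eta> where "cmod \<eta> = 1" "dist \<zeta> \<eta> < \<epsilon>" "dist \<zeta> \<eta> < e" "H \<eta> \<notin> N"
proof -
  have e: "e > 0" and qz: "poly q \<zeta> \<noteq> 0" 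
    and Hd: "\<And>z. z \<in> ball \<zeta> e \<Longrightarrow> (H has_field_derivative poly p z / poly q z) (at z)"
    using H by (auto simp: extends_def)
  have Hol: "H holomorphic_on ball \<zeta> e"
    unfolding holomorphic_on_open[OF open_ball] using Hd by blast
  have "deriv H \<zeta> \<noteq> 0" using DERIV_imp_deriv[OF Hd[of \<zeta>]] e qz \<zeta>(2) by simp
  then obtain \<rho> where \<rho>: "\<rho> > 0" "inj_on H (ball \<zeta> \<rho>)"
    using has_complex_derivative_locally_injective[OF Hol _ open_ball, of \<zeta>] e by auto
  define d where "d = Min {\<epsilon>, e, \<rho>}"
  have d: "d > 0" "d \<le> \<epsilon>" "d \<le> e" "d \<le> \<rho>" using \<epsilon> e \<rho> by (auto simp: d_def)
  define t where "t = Arg \<zeta>"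
  have t: "cis t = \<zeta>" using \<zeta>(1) by (metis cis_Arg_unique rcis_cmod_Arg mult_1 of_real_1 rcis_def t_def)
  have "isCont cis t" using continuous_on_cis[OF continuous_on_id, of UNIV] by (simp add: continuous_on_eq_continuous_at)
  then obtain s0 where s0: "s0 > 0" "\<And>s. dist s t < s0 \<Longrightarrow> dist (cis s) \<zeta> < d"
    using d(1) t unfolding continuous_at_eps_delta by blast
  \<comment> \<open>Halving puts the closed arc inside the open ball; the bound 1, being below
    \<pi>, makes its end points distinct.\<close>
  define s where "s = min (s0 / 2) 1"
  have s: "0 < s" "s < s0" "s \<le> 1" using s0 by (auto simp: s_def)
  define T where "T = cis ` {t..t + s}"
  have T: "T \<subseteq> ball \<zeta> d" "T \<subseteq> sphere 0 1"
    using s s0(2) by (auto simp: T_def dist_real_def dist_commute)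
  have "connected T" unfolding T_def
    by (intro connected_continuous_image continuous_intros) auto
  moreover have "continuous_on T H"
    using holomorphic_on_imp_continuous_on[OF Hol] by (rule continuous_on_subset) (use T d in auto)
  ultimately have con: "connected (H ` T)" by (rule connected_continuous_image[rotated])
  have "\<not> H ` T \<subseteq> N"
  proof
    assume "H ` T \<subseteq> N"
    moreover have mem: "cis t \<in> T" "cis (t + s) \<in> T" using s by (auto simp: T_def)
    ultimately have "H (cis t) = H (cis (t + s))"
      using h1_null_connected_imp_eq[OF N con] by blast
    moreover have "cis t \<in> ball \<zeta> \<rho>" "cis (t + s) \<in> ball \<zeta> \<rho>" using mem T d by auto
    ultimately have "cis t = cis (t + s)" using \<rho>(2) by (meson inj_onD)
    then have "cis t * cis s = cis t * 1" by (metis cis_mult mult.right_neutral)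
    then have "cis s = 1" by simp
    then have "cos s = 1" by (simp add: complex_eq_iff)
    moreover have "cos s < cos 0" using s pi_gt3 by (intro cos_monotone_0_pi) auto
    ultimately show False by simp
  qed
  then obtain \<eta> where \<eta>: "\<eta> \<in> T" "H \<eta> \<notin> N" by blast
  have "dist \<zeta> \<eta> < d" "cmod \<eta> = 1" using T \<eta>(1) by auto
  then show ?thesis using that \<eta> d by auto
qed

text \<open>At good circle points this is the chain rule: the left factor \<open>cgrad u\<close> has
  modulus tending to \<open>c\<close> along the radius. The defect \<psi> is continuous, so a
  nonzero value at \<zeta> would persist nearby, where a good point can be found.\<close>

lemma boundary_modulus_identity:
  assumes nd: "\<And>\<zeta>. \<zeta> \<in> frontier \<Omega> - N \<Longrightarrow> normal_derivative_is \<Omega> u \<zeta> c" and N: "h1_null N"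
    and PQ: "\<And>z. cmod z < 1 \<Longrightarrow> cgrad u (h z) * deriv h z = poly P z / poly Q z" and Q: "Q \<noteq> 0"
    and \<zeta>: "cmod \<zeta> = 1"
  shows "cmod (poly P \<zeta> * poly q \<zeta>) = c * cmod (poly Q \<zeta> * poly p \<zeta>)"
proof (rule ccontr)
  define \<psi> where "\<psi> z = cmod (poly P z * poly q z) - c * cmod (poly Q z * poly p z)" for z
  assume "\<not> ?thesis"
  then have nz: "\<psi> \<zeta> \<noteq> 0" by (simp add: \<psi>_def)
  have "isCont \<psi> \<zeta>" unfolding \<psi>_def by (intro continuous_intros)
  then obtain \<epsilon> where \<epsilon>: "\<epsilon> > 0" "\<And>z. dist \<zeta> z < \<epsilon> \<Longrightarrow> \<psi> z \<noteq> 0"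
    using continuous_at_avoid[of \<zeta> \<psi> 0] nz by blast
  define B where "B = {z. poly (Q * q * p) z = 0}"
  have B: "finite B" unfolding B_def using Q q0 p0 by (intro poly_roots_finite) simp
  have "infinite (sphere 0 1 \<inter> ball \<zeta> \<epsilon> - B)" 
    using infinite_circle_near[OF \<zeta> \<epsilon>(1)] B by (rule Diff_infinite_finite[rotated])
  \<comment> \<open>The good point is reached in two moves: \<open>\<eta>0\<close> avoids the
    finitely many zeros of \<open>Q\<close>, \<open>q\<close> and \<open>p\<close>, and then \<eta>,
    close to it, avoids the preimage of \<open>N\<close>.\<close>
  then obtain \<eta>0 where \<eta>0: "\<eta>0 \<in> sphere 0 1 \<inter> ball \<zeta> \<epsilon> - B"
    by (metis ex_in_conv finite.emptyI)
  then have n0: "cmod \<eta>0 = 1" "dist \<zeta> \<eta>0 < \<epsilon>" "poly q \<eta>0 \<noteq> 0" "poly p \<eta>0 \<noteq> 0" by (auto simp: B_def)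
  obtain e H where H: "extends \<eta>0 e H" by (rule extension_exists[OF n0(3)])
  have "open (ball \<zeta> \<epsilon> - B)" using B by (intro open_Diff open_ball finite_imp_closed)
  moreover have "\<eta>0 \<in> ball \<zeta> \<epsilon> - B" using \<eta>0 by blast
  ultimately obtain \<delta> where \<delta>: "\<delta> > 0" "ball \<eta>0 \<delta> \<subseteq> ball \<zeta> \<epsilon> - B" by (rule openE)
  obtain \<eta> where \<eta>: "cmod \<eta> = 1" "dist \<eta>0 \<eta> < \<delta>" "dist \<eta>0 \<eta> < e" "H \<eta> \<notin> N"
    by (rule nonnull_circle_point_near[OF N H n0(1,4) \<delta>(1)])
  have "\<eta> \<in> ball \<zeta> \<epsilon> - B" using \<delta> \<eta> by auto
  then have ne: "dist \<zeta> \<eta> < \<epsilon>" "poly Q \<eta> \<noteq> 0" "poly q \<eta> \<noteq> 0" "poly p \<eta> \<noteq> 0" by (auto simp: B_def)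
  define e' where "e' = e - dist \<eta>0 \<eta>"
  have e': "ball \<eta> e' \<subseteq> ball \<eta>0 e" 
    by (auto simp: e'_def) (metis add_less_cancel_left diff_add_cancel dist_triangle order_le_less_trans add.commute less_diff_eq)
  have H': "extends \<eta> e' H"
    using H e' \<eta>(3) unfolding extends_def by (auto simp: e'_def)
  have "H \<eta> \<in> frontier \<Omega> - N"
    using extends_frontier(1)[OF H _ \<eta>(1)] \<eta> by auto
  from normal_derivative_radial[OF H' \<eta>(1) ne(4) nd[OF this]]
  have lim: "(\<lambda>n. grad_norm u (h (radial \<eta> n))) \<longlonglongrightarrow> c" .
  have "(\<lambda>n. poly f (radial \<eta> n)) \<longlonglongrightarrow> poly f \<eta>" for f
    by (rule isCont_tendsto_compose[OF _ radial(4)[OF \<eta>(1)]]) (intro continuous_intros)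
  then have lim1: "(\<lambda>n. grad_norm u (h (radial \<eta> n)) * cmod (poly p (radial \<eta> n)) * cmod (poly Q (radial \<eta> n))) 
      \<longlonglongrightarrow> c * cmod (poly p \<eta>) * cmod (poly Q \<eta>)"
    and lim2: "(\<lambda>n. cmod (poly P (radial \<eta> n)) * cmod (poly q (radial \<eta> n))) \<longlonglongrightarrow> cmod (poly P \<eta>) * cmod (poly q \<eta>)"
    and limQ: "(\<lambda>n. poly Q (radial \<eta> n)) \<longlonglongrightarrow> poly Q \<eta>"
    by (simp_all add: tendsto_mult tendsto_norm lim)
  have "\<forall>\<^sub>F n in sequentially. grad_norm u (h (radial \<eta> n)) * cmod (poly p (radial \<eta> n)) * cmod (poly Q (radial \<eta> n))
    = cmod (poly P (radial \<eta> n)) * cmod (poly q (radial \<eta> n))"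
    using tendsto_imp_eventually_ne[OF limQ ne(2)]
  proof eventually_elim
    case (elim n)
    let ?z = "radial \<eta> n"
    have z: "cmod ?z < 1" by (rule radial(2)[OF \<eta>(1)])
    have "cmod (cgrad u (h ?z) * deriv h ?z) = cmod (poly P ?z / poly Q ?z)" using PQ[OF z] by simp
    then have "grad_norm u (h ?z) * (cmod (poly p ?z) / cmod (poly q ?z)) = cmod (poly P ?z) / cmod (poly Q ?z)"
      using z by (simp add: norm_mult norm_divide cmod_cgrad deriv_h)
    then show ?case using elim poly_nz(2)[OF z] by (simp add: field_simps)
  qed
  with lim1 have "(\<lambda>n. cmod (poly P (radial \<eta> n)) * cmod (poly q (radial \<eta> n))) \<longlonglongrightarrow> c * cmod (poly p \<eta>) * cmod (poly Q \<eta>)"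
    by (rule Lim_transform_eventually)
  with lim2 have "cmod (poly P \<eta>) * cmod (poly q \<eta>) = c * cmod (poly p \<eta>) * cmod (poly Q \<eta>)" by (rule LIMSEQ_unique)
  then have "\<psi> \<eta> = 0" by (simp add: \<psi>_def norm_mult mult_ac)
  with \<epsilon>(2)[OF ne(1)] show False by simp
qed

end

section \<open>Polynomials of proportional modulus on the circle\<close>

lemma continuous_eq_on_circle:
  fixes f g :: "complex \<Rightarrow> real"
  assumes eq: "\<And>z. cmod z = 1 \<Longrightarrow> z \<noteq> a \<Longrightarrow> f z = g z" and c: "isCont f a" "isCont g a" and a: "cmod a = 1"
  shows "f a = g a"
proof (rule ccontr)
  assume ne: "f a \<noteq> g a"
  have "isCont (\<lambda>z. f z - g z) a" using c by (intro continuous_intros)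
  then obtain e where e: "e > 0" "\<And>z. dist a z < e \<Longrightarrow> f z - g z \<noteq> 0"
    using continuous_at_avoid[of a "\<lambda>z. f z - g z" 0] ne by auto
  have "infinite (sphere 0 1 \<inter> ball a e - {a})"
    using infinite_circle_near[OF a e(1)] by simp
  then obtain z where "z \<in> sphere 0 1 \<inter> ball a e - {a}" by (metis ex_in_conv finite.emptyI)
  then show False using e(2)[of z] eq[of z] by simp
qed

lemma infinite_circle: "infinite {z. cmod z = 1}"
proof -
  have "infinite (sphere 0 1 \<inter> ball (1::complex) 1)" by (rule infinite_circle_near) auto
  then have "infinite (sphere (0::complex) 1)" using finite_Int by blast
  then show ?thesis by (simp add: sphere_def)
qed

lemma bounded_by_boundary_modulus:
  fixes P Q :: "complex poly"
  assumes mod: "\<And>z. cmod z = 1 \<Longrightarrow> cmod (poly P z) = c * cmod (poly Q z)"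
    and Q: "\<And>z. cmod z \<le> 1 \<Longrightarrow> poly Q z \<noteq> 0" and z: "cmod z < 1"
  shows "cmod (poly P z) \<le> c * cmod (poly Q z)"
proof -
  have cont: "continuous_on (cball 0 1) (\<lambda>z. poly P z / poly Q z)"
    using Q by (intro continuous_intros) auto
  have hol: "(\<lambda>z. poly P z / poly Q z) holomorphic_on ball 0 1"
    using Q by (intro holomorphic_intros) auto
  have "cmod (poly P z / poly Q z) \<le> c"
  proof (rule maximum_modulus_frontier[where S = "ball 0 1" and f = "\<lambda>z. poly P z / poly Q z"])
    show "cmod (poly P w / poly Q w) \<le> c" if "w \<in> frontier (ball 0 1)" for w
      using that mod[of w] Q[of w] by (simp add: norm_divide)
  qed (use z cont hol in auto)
  then show ?thesis using Q[of z] z by (simp add: norm_divide divide_le_eq)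
qed

text \<open>The maximum principle for both quotients gives constant modulus in the disc, hence a
  constant quotient there; infinitely many common values make the polynomials proportional.\<close>

lemma proportional_if_nonvanishing:
  fixes P Q :: "complex poly"
  assumes mod: "\<And>z. cmod z = 1 \<Longrightarrow> cmod (poly P z) = c * cmod (poly Q z)" and c: "c > 0"
    and P: "\<And>z. cmod z \<le> 1 \<Longrightarrow> poly P z \<noteq> 0" and Q: "\<And>z. cmod z \<le> 1 \<Longrightarrow> poly Q z \<noteq> 0"
  shows "\<exists>K. P = smult K Q"
proof -
  let ?f = "\<lambda>z. poly P z / poly Q z"
  have hol: "?f holomorphic_on ball 0 1" using Q by (intro holomorphic_intros) auto
  have eq: "cmod (?f z) = c" if z: "cmod z < 1" for z
  proof (rule antisym)
    show "cmod (?f z) \<le> c" using bounded_by_boundary_modulus[OF mod Q z] Q[of z] z by (simp add: norm_divide divide_le_eq)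
    have "cmod (poly Q z) \<le> 1 / c * cmod (poly P z)"
      by (rule bounded_by_boundary_modulus[OF _ P z]) (use mod c in auto)
    then show "c \<le> cmod (?f z)" using Q[of z] z c by (simp add: norm_divide field_simps)
  qed
  have "?f constant_on ball 0 1"
    by (rule maximum_modulus_principle[OF hol, where U = "ball 0 1" and \<xi> = 0]) (auto simp: eq simp del: norm_divide)
  then obtain K where K: "\<And>z. cmod z < 1 \<Longrightarrow> ?f z = K" unfolding constant_on_def by auto
  have "poly (P - smult K Q) z = 0" if "cmod z < 1" for z
    using K[OF that] Q[of z] that by (simp add: field_simps)
  then have "ball 0 1 \<subseteq> {z. poly (P - smult K Q) z = 0}" by auto
  moreover have "infinite (ball (0::complex) 1)" 
    using uncountable_ball[of 1 "0::complex"] countable_finite by auto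
  ultimately have "P - smult K Q = 0" using poly_roots_finite finite_subset by blast
  then show ?thesis by (intro exI[of _ K]) simp
qed

text \<open>Zeros on the circle are shared by both polynomials because of the modulus relation. They
  are cancelled one at a time, by induction on the degree, until neither polynomial vanishes on the
  closed disc.\<close>

lemma proportional_if_equal_modulus_on_circle:
  fixes P Q :: "complex poly"
  assumes "\<And>z. cmod z = 1 \<Longrightarrow> cmod (poly P z) = c * cmod (poly Q z)" and "c \<noteq> 0"
    and "\<And>z. cmod z < 1 \<Longrightarrow> poly P z \<noteq> 0" and "\<And>z. cmod z < 1 \<Longrightarrow> poly Q z \<noteq> 0"
  obtains K where "K \<noteq> 0" "P = smult K Q"
proof -
  \<comment> \<open>For \<open>c\<close> not positive the relation would make \<open>P\<close>
    vanish on the whole circle.\<close>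
  have c: "c > 0"
  proof (rule ccontr)
    assume "\<not> c > 0"
    then have "c * cmod (poly Q z) \<le> 0" for z by (intro mult_nonpos_nonneg) auto
    then have "poly P z = 0" if "cmod z = 1" for z using assms(1)[OF that] by (metis norm_le_zero_iff)
    then have "{z. cmod z = 1} \<subseteq> {z. poly P z = 0}" by auto
    then have "P = 0" using poly_roots_finite infinite_circle finite_subset by blast
    then show False using assms(3)[of 0] by simp
  qed
  have "\<exists>K. P = smult K Q"
    using assms(1,3,4)
  proof (induction "degree Q" arbitrary: P Q rule: less_induct)
    case less
    show ?case
    proof (cases "\<exists>a. cmod a = 1 \<and> poly Q a = 0")
      case False
      have "poly Q z \<noteq> 0" if "cmod z \<le> 1" for z
        using False less.prems(3)[of z] that by (cases "cmod z = 1") auto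
      moreover have "poly P z \<noteq> 0" if "cmod z \<le> 1" for z
        using False less.prems(1)[of z] less.prems(2)[of z] that c by (cases "cmod z = 1") auto
      ultimately show ?thesis using proportional_if_nonvanishing[OF less.prems(1) c] by blast
    next
      case True
      then obtain a where a: "cmod a = 1" "poly Q a = 0" by blast
      then have "poly P a = 0" using less.prems(1)[of a] by simp
      with a obtain P' Q' where P': "P = [:-a, 1:] * P'" and Q': "Q = [:-a, 1:] * Q'"
        unfolding poly_eq_0_iff_dvd by (elim dvdE) 
      have Q0: "Q \<noteq> 0" using less.prems(3)[of 0] by auto
      have "\<exists>K. P' = smult K Q'"
      proof (rule less.hyps)
        show "degree Q' < degree Q" using Q0 unfolding Q' by (subst degree_mult_eq) auto
        \<comment> \<open>Cancelling the linear factor says nothing at \<open>a\<close> itself;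
          there the relation is recovered by continuity.\<close>
        have off: "cmod (poly P' z) = c * cmod (poly Q' z)" if "cmod z = 1" "z \<noteq> a" for z
          using less.prems(1)[OF that(1)] that(2) by (simp add: P' Q' norm_mult flip: left_diff_distrib)
        then show "cmod (poly P' z) = c * cmod (poly Q' z)" if "cmod z = 1" for z
          using continuous_eq_on_circle[of a "\<lambda>z. cmod (poly P' z)" "\<lambda>z. c * cmod (poly Q' z)"] a(1) that
          by (cases "z = a") (auto intro!: continuous_intros)
        show "poly P' z \<noteq> 0" "poly Q' z \<noteq> 0" if "cmod z < 1" for z
          using less.prems(2,3)[OF that] by (auto simp: P' Q')
      qed
      then obtain K where "P' = smult K Q'" ..
      then show ?thesis by (intro exI[of _ K]) (simp add: P' Q')
    qed
  qed
  then obtain K where K: "P = smult K Q" ..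
  moreover have "K \<noteq> 0" using K assms(3)[of 0] by auto
  ultimately show ?thesis using that by blast
qed

section \<open>The two-pole case\<close>

lemma Re_of_real_times: "Re (of_real x * z) = x * Re z"
  by simp

text \<open>For \<open>a\<close> of modulus 1 this is the Poisson kernel. For two points of equal
  modulus it shows that the additive constant in \<open>om\<close> is imaginary.\<close>

lemma Re_divide_add_diff:
  "Re ((a + z) / (a - z)) = ((cmod a)\<^sup>2 - (cmod z)\<^sup>2) / (cmod (a - z))\<^sup>2"
proof -
  have "(a + z) / (a - z) = (a + z) * cnj (a - z) / of_real ((cmod (a - z))\<^sup>2)"
    by (rule complex_div_cnj[unfolded of_real_power[symmetric]])
  also have "Re \<dots> = Re ((a + z) * cnj (a - z)) / (cmod (a - z))\<^sup>2"
    by (rule Re_divide_of_real)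
  also have "Re ((a + z) * cnj (a - z)) = (cmod a)\<^sup>2 - (cmod z)\<^sup>2"
    unfolding cmod_power2 by (simp add: algebra_simps power2_eq_square)
  finally show ?thesis .
qed

locale two_pole_map = rational_conformal_map +
  fixes a1 a2 :: complex
  assumes a: "cmod a1 = 1" "cmod a2 = 1" "a1 \<noteq> a2"
    and poles: "\<And>z. cmod z = 1 \<Longrightarrow> poly q z = 0 \<longleftrightarrow> z = a1 \<or> z = a2"
    and cop: "coprime p q"
begin

lemma a_nz: "a1 \<noteq> 0" "a2 \<noteq> 0" "a1 - a2 \<noteq> 0"
  using a by auto

lemma disc_nz: "cmod z < 1 \<Longrightarrow> a1 - z \<noteq> 0" "cmod z < 1 \<Longrightarrow> a2 - z \<noteq> 0"
  "cmod z < 1 \<Longrightarrow> z - a1 \<noteq> 0" "cmod z < 1 \<Longrightarrow> z - a2 \<noteq> 0"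
  using a by auto

lemma p_nz_at_pole: "poly q z = 0 \<Longrightarrow> poly p z \<noteq> 0"
  using coprime_poly_0[OF cop, of z] by auto

text \<open>A Moebius map of the disc onto the right half-plane sending \<open>a1\<close> to infinity and \<open>a2\<close> to \<open>0\<close>.\<close>

definition om :: "complex \<Rightarrow> complex" where
  "om z = (a1 + z) / (a1 - z) - (a1 + a2) / (a1 - a2)"

lemma Re_om: "Re (om z) = (1 - (cmod z)\<^sup>2) / (cmod (a1 - z))\<^sup>2"
  unfolding om_def minus_complex.simps Re_divide_add_diff using a by simp

lemma Re_om_pos: "cmod z < 1 \<Longrightarrow> Re (om z) > 0"
  unfolding Re_om using disc_nz(1)[of z] by (intro divide_pos_pos) (auto simp: power_less_one_iff)

lemma om_nz: "cmod z < 1 \<Longrightarrow> om z \<noteq> 0"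
  using Re_om_pos[of z] by auto

lemma om_eq: "z \<noteq> a1 \<Longrightarrow> om z = 2 * a1 / (a2 - a1) * ((z - a2) / (z - a1))"
  unfolding om_def using a(3) by (simp add: divide_simps) (simp add: algebra_simps)

lemma om_has_deriv: "z \<noteq> a1 \<Longrightarrow> (om has_field_derivative 2 * a1 / (a1 - z)\<^sup>2) (at z)"
proof -
  assume z: "z \<noteq> a1"
  have "((\<lambda>z. (a1 + z) / (a1 - z)) has_field_derivative 2 * a1 / (a1 - z)\<^sup>2) (at z)"
    using z by (auto intro!: derivative_eq_intros simp: power2_eq_square algebra_simps)
  from DERIV_diff[OF this DERIV_const] show ?thesis by (simp add: om_def[abs_def])
qed

lemma om_surj:
  assumes "Re X > 0"
  obtains z where "cmod z < 1" "om z = X"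
proof -
  \<comment> \<open>Undoing the imaginary shift leaves a Cayley transform to invert.\<close>
  define Y where "Y = X + (a1 + a2) / (a1 - a2)"
  have Y: "Re Y > 0" using assms a by (simp add: Y_def Re_divide_add_diff)
  then have Y1: "Y + 1 \<noteq> 0" by (metis add_neg_nonpos add_eq_0_iff less_numeral_extra(1) minus_complex.simps(1) one_complex.simps(1) order_less_asym uminus_complex.simps(1) neg_less_0_iff_less)
  define z where "z = a1 * ((Y - 1) / (Y + 1))"
  have "(cmod (Y - 1))\<^sup>2 < (cmod (Y + 1))\<^sup>2"
    unfolding cmod_power2 using Y by (simp add: power2_eq_square algebra_simps)
  then have "cmod (Y - 1) < cmod (Y + 1)" by (rule power_less_imp_less_base) simp
  then have "cmod z < 1" using a Y1 by (simp add: z_def norm_mult norm_divide)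
  moreover have "(a1 + z) / (a1 - z) = Y"
  proof -
    have "a1 + z = a1 * (2 * Y / (Y + 1))" "a1 - z = a1 * (2 / (Y + 1))"
      using Y1 by (simp_all add: z_def divide_simps) (simp_all add: algebra_simps)
    then show ?thesis using a_nz Y1 by simp
  qed
  ultimately show ?thesis using that by (simp add: om_def Y_def)
qed

text \<open>The kernel at \<open>a2\<close>, shifted by an imaginary constant so as to vanish at
  \<open>a1\<close>, is a constant multiple of \<open>1 / om\<close>; this is that constant.\<close>

definition \<alpha> :: real where "\<alpha> = 4 / (cmod (a1 - a2))\<^sup>2"

lemma \<alpha>_pos: "\<alpha> > 0"
  using a by (simp add: \<alpha>_def)

text \<open>On the unit circle \<open>cnj a = 1 / a\<close>, which turns the modulus into a rational
  expression usable in field identities.\<close>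

lemma \<alpha>_eq: "of_real \<alpha> = - 4 * a1 * a2 / (a1 - a2)\<^sup>2"
proof -
  have "cnj a1 = 1 / a1" "cnj a2 = 1 / a2"
    using a complex_norm_square[of a1] complex_norm_square[of a2] a_nz by (simp_all add: field_simps)
  then have "of_real ((cmod (a1 - a2))\<^sup>2) = (a1 - a2) * (1 / a1 - 1 / a2)"
    by (simp only: complex_norm_square complex_cnj_diff)
  also have "\<dots> = - ((a1 - a2)\<^sup>2 / (a1 * a2))" using a_nz by (simp add: divide_simps power2_eq_square) (simp add: algebra_simps)
  finally have d: "of_real ((cmod (a1 - a2))\<^sup>2) = - ((a1 - a2)\<^sup>2 / (a1 * a2))" .
  have "of_real \<alpha> = 4 / complex_of_real ((cmod (a1 - a2))\<^sup>2)" by (simp add: \<alpha>_def)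
  then show ?thesis unfolding d by simp
qed

lemma second_kernel: 
  assumes "cmod z < 1"
  shows "(a2 + z) / (a2 - z) = of_real \<alpha> / om z - (a1 + a2) / (a1 - a2)"
proof -
  have "z \<noteq> a1" using disc_nz[OF assms] by auto
  then have "of_real \<alpha> / om z = 2 * a2 / (a1 - a2) * ((z - a1) / (z - a2))"
    unfolding \<alpha>_eq om_eq[OF \<open>z \<noteq> a1\<close>] using a_nz disc_nz[OF assms] 
    by (simp add: divide_simps power2_eq_square) (simp add: algebra_simps)
  moreover have "(a2 + z) / (a2 - z) + (a1 + a2) / (a1 - a2) = 2 * a2 / (a1 - a2) * ((z - a1) / (z - a2))"
    using a_nz disc_nz[OF assms] by (simp add: divide_simps) (simp add: algebra_simps)
  ultimately show ?thesis by (simp add: algebra_simps)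
qed

lemma roof_representation:
  assumes u: "roof_function \<Omega> u"
  obtains m1 m2 c N where "m1 \<ge> 0" "m2 \<ge> 0" 
    "\<And>z. cmod z < 1 \<Longrightarrow> u (h z) = m1 * Re (om z) + m2 * Re (of_real \<alpha> / om z)"
    "\<And>z. cmod z < 1 \<Longrightarrow> cgrad u (h z) * deriv h z = of_real m1 * (2 * a1 / (a1 - z)\<^sup>2) + of_real m2 * (2 * a2 / (a2 - z)\<^sup>2)"
    "c \<noteq> 0" "h1_null N" "\<And>\<zeta>. \<zeta> \<in> frontier \<Omega> - N \<Longrightarrow> normal_derivative_is \<Omega> u \<zeta> c"
proof -
  from u obtain c N where har: "harmonic_on \<Omega> u" and pos: "\<And>z. z \<in> \<Omega> \<Longrightarrow> u z > 0"
    and zero: "\<And>\<zeta>. \<zeta> \<in> frontier \<Omega> \<Longrightarrow> (u \<longlongrightarrow> 0) (at \<zeta> within \<Omega>)"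
    and cN: "c \<noteq> 0" "h1_null N" "\<And>\<zeta>. \<zeta> \<in> frontier \<Omega> - N \<Longrightarrow> normal_derivative_is \<Omega> u \<zeta> c"
    unfolding roof_function_def by blast
  have hin: "h z \<in> \<Omega>" if "cmod z < 1" for z using img that by auto
  have sub: "h ` ball 0 1 \<subseteq> \<Omega>" using img by simp
  obtain F where F: "F holomorphic_on ball 0 1" "\<And>z. z \<in> ball 0 1 \<Longrightarrow> Re (F z) = u (h z)"
    "\<And>z. z \<in> ball 0 1 \<Longrightarrow> (F has_field_derivative cgrad u (h z) * deriv h z) (at z)"
    by (rule harmonic_pullback_completion[OF har open_ball convex_ball hol sub]) (rule that; simp)
  interpret T: two_point_boundary F a1 a2
  proof
    show "Re (F z) \<ge> 0" if "cmod z < 1" for z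
      using F(2)[of z] pos[OF hin[OF that]] that by simp
    show "((\<lambda>z. Re (F z)) \<longlongrightarrow> 0) (at \<zeta> within ball 0 1)" if "cmod \<zeta> = 1" "\<zeta> \<noteq> a1" "\<zeta> \<noteq> a2" for \<zeta>
    proof (rule Lim_transform_within[OF boundary_value_zero[OF zero that(1)], where d = 1])
      show "poly q \<zeta> \<noteq> 0" using poles that by simp
    qed (use F(2) in auto)
  qed (use F a in auto)
  obtain m1 m2 where m: "m1 \<ge> 0" "m2 \<ge> 0" and rep: "\<And>z. cmod z < 1 \<Longrightarrow>
     F z = of_real m1 * ((a1 + z) / (a1 - z)) + of_real m2 * ((a2 + z) / (a2 - z)) + \<i> * of_real (Im (F 0))"
    by (rule T.representation) blast
  have 1: "u (h z) = m1 * Re (om z) + m2 * Re (of_real \<alpha> / om z)" if z: "cmod z < 1" for z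
  proof -
    have "Re ((a1 + a2) / (a1 - a2)) = 0" by (simp add: Re_divide_add_diff a)
    then have "Re ((a1 + z) / (a1 - z)) = Re (om z)" "Re ((a2 + z) / (a2 - z)) = Re (of_real \<alpha> / om z)"
      unfolding second_kernel[OF z] om_def by simp_all
    moreover have "u (h z) = Re (F z)" using F(2)[of z] z by simp
    ultimately show ?thesis unfolding rep[OF z] plus_complex.simps Re_of_real_times by simp
  qed
  have 2: "cgrad u (h z) * deriv h z = of_real m1 * (2 * a1 / (a1 - z)\<^sup>2) + of_real m2 * (2 * a2 / (a2 - z)\<^sup>2)"
    if z: "cmod z < 1" for z
  proof (rule DERIV_unique)
    show "(F has_field_derivative cgrad u (h z) * deriv h z) (at z)" using F(3) z by simp
    have k: "((\<lambda>z. (b + z) / (b - z)) has_field_derivative 2 * b / (b - z)\<^sup>2) (at z)" if "b - z \<noteq> 0" for b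
      using that by (auto intro!: derivative_eq_intros simp: power2_eq_square algebra_simps)
    have "((\<lambda>z. of_real m1 * ((a1 + z) / (a1 - z)) + of_real m2 * ((a2 + z) / (a2 - z)) + \<i> * of_real (Im (F 0)))
      has_field_derivative of_real m1 * (2 * a1 / (a1 - z)\<^sup>2) + of_real m2 * (2 * a2 / (a2 - z)\<^sup>2) + 0) (at z)"
      by (intro DERIV_add DERIV_cmult k disc_nz[OF z] DERIV_const)
    then have R: "((\<lambda>z. of_real m1 * ((a1 + z) / (a1 - z)) + of_real m2 * ((a2 + z) / (a2 - z)) + \<i> * of_real (Im (F 0)))
      has_field_derivative of_real m1 * (2 * a1 / (a1 - z)\<^sup>2) + of_real m2 * (2 * a2 / (a2 - z)\<^sup>2)) (at z)"
      unfolding add_0_right .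
    show "(F has_field_derivative of_real m1 * (2 * a1 / (a1 - z)\<^sup>2) + of_real m2 * (2 * a2 / (a2 - z)\<^sup>2)) (at z)"
    proof (rule has_field_derivative_transform_within_open[OF R open_ball[of 0 1]])
      show "of_real m1 * ((a1 + x) / (a1 - x)) + of_real m2 * ((a2 + x) / (a2 - x)) + \<i> * of_real (Im (F 0)) = F x"
        if "x \<in> ball 0 1" for x
        using that by (intro rep[symmetric]) simp
    qed (use z in simp)
  qed
  from that[OF m 1 2 cN] show ?thesis by blast
qed

text \<open>With a kernel at \<open>b\<close> only, \<open>F'\<close> is finite at the other pole
  \<open>a\<close>. The cleared identity at \<open>a\<close> has 0 on the left because
  \<open>q\<close> vanishes there, so \<open>p\<close> would vanish there too, against
  coprimality.\<close>

lemma single_kernel_impossible: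
  assumes "\<And>z. cmod z < 1 \<Longrightarrow> cgrad u (h z) * deriv h z = of_real m * (2 * b / (b - z)\<^sup>2)"
    and "c \<noteq> 0" "h1_null N" "\<And>\<zeta>. \<zeta> \<in> frontier \<Omega> - N \<Longrightarrow> normal_derivative_is \<Omega> u \<zeta> c"
    and b: "cmod b = 1" "b \<noteq> a" and a: "cmod a = 1" "poly q a = 0"
  shows False
proof -
  let ?P = "[:of_real m * 2 * b:]" and ?Q = "[:b, -1:]\<^sup>2"
  have "cmod (poly ?P a * poly q a) = c * cmod (poly ?Q a * poly p a)"
  proof (rule boundary_modulus_identity[OF assms(4,3) _ _ a(1)])
    show "cgrad u (h z) * deriv h z = poly ?P z / poly ?Q z" if "cmod z < 1" for z
      using assms(1)[OF that] by simp
    show "?Q \<noteq> 0" by (metis pCons_eq_0_iff power_not_zero zero_neq_neg_one)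
  qed
  with a assms(2) b(2) have "poly p a = 0" by simp
  with p_nz_at_pole[OF a(2)] show False by simp
qed

lemma roof_normal_form:
  assumes u: "roof_function \<Omega> u"
  obtains s C :: real and K where "s > 0" "C > 0" "K \<noteq> 0"
    "\<And>z. cmod z < 1 \<Longrightarrow> u (h z) = C * Re (of_real s * om z + 1 / (of_real s * om z))"
    "\<And>z. cmod z < 1 \<Longrightarrow> deriv h z = K * ((1 + of_real s * om z) / (of_real s * om z))\<^sup>2 * (2 * a1 / (a1 - z)\<^sup>2)"
proof -
  obtain m1 m2 c N where m: "m1 \<ge> 0" "m2 \<ge> 0" 
    and U: "\<And>z. cmod z < 1 \<Longrightarrow> u (h z) = m1 * Re (om z) + m2 * Re (of_real \<alpha> / om z)"
    and F': "\<And>z. cmod z < 1 \<Longrightarrow> cgrad u (h z) * deriv h z = of_real m1 * (2 * a1 / (a1 - z)\<^sup>2) + of_real m2 * (2 * a2 / (a2 - z)\<^sup>2)"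
    and c: "c \<noteq> 0" and N: "h1_null N" and nd: "\<And>\<zeta>. \<zeta> \<in> frontier \<Omega> - N \<Longrightarrow> normal_derivative_is \<Omega> u \<zeta> c"
    by (rule roof_representation[OF u]) blast
  have "m1 \<noteq> 0"
  proof
    assume "m1 = 0"
    then show False using single_kernel_impossible[of u m2 a2 c N a1] F' c N nd a poles by auto
  qed
  moreover have "m2 \<noteq> 0"
  proof
    assume "m2 = 0"
    then show False using single_kernel_impossible[of u m1 a1 c N a2] F' c N nd a poles by auto
  qed
  ultimately have m: "m1 > 0" "m2 > 0" using m by auto
  \<comment> \<open>With \<open>w = s * om\<close> the weights of \<open>w\<close> and
    \<open>1 / w\<close> are \<open>m1 / s\<close> and \<open>m2 * \<alpha> * s\<close>; this
    \<open>s\<close> makes them equal.\<close>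
  define s where "s = sqrt (m1 / (m2 * \<alpha>))"
  have s: "s > 0" using m \<alpha>_pos by (simp add: s_def)
  have s2: "m2 * \<alpha> = m1 / s\<^sup>2" using m \<alpha>_pos by (simp add: s_def)
  have 1: "u (h z) = m1 / s * Re (of_real s * om z + 1 / (of_real s * om z))" if z: "cmod z < 1" for z
  proof -
    have "m2 * Re (of_real \<alpha> / om z) = Re (of_real (m2 * \<alpha>) / om z)"
      by (metis Re_of_real_times of_real_mult times_divide_eq_right)
    also have "\<dots> = Re (of_real (m1 / s) * (1 / (of_real s * om z)))"
      unfolding s2 by (simp add: power2_eq_square mult.assoc)
    also have "\<dots> = m1 / s * Re (1 / (of_real s * om z))" by (rule Re_of_real_times)
    finally show ?thesis using U[OF z] s by (simp add: distrib_left)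
  qed
  define A B where "A = [:-a1, 1:]" and "B = [:-a2, 1:]"
  define \<kappa> where "\<kappa> = of_real s * (2 * a1 / (a2 - a1))"
  have \<kappa>: "\<kappa> \<noteq> 0" using s a a_nz by (simp add: \<kappa>_def)
  have om: "of_real s * om z = \<kappa> * poly B z / poly A z" if "z \<noteq> a1" for z
    unfolding om_eq[OF that] by (simp add: A_def B_def \<kappa>_def)
  have AB: "poly A z = z - a1" "poly B z = z - a2" for z by (simp_all add: A_def B_def)
  \<comment> \<open>\<open>P / Q\<close> is \<open>m1 * (1 - 1 / w^2)\<close> times the derivative
    of \<open>om\<close>, written with \<open>w = \<kappa> * B / A\<close> and cleared of
    fractions.\<close>
  define P where "P = smult (of_real m1 * (2 * a1)) ((smult \<kappa> B - A) * (smult \<kappa> B + A))"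
  define Q where "Q = smult (\<kappa>\<^sup>2) (A * A * (B * B))"
  have der2: "of_real (m2 * \<alpha>) / (om z)\<^sup>2 * (2 * a1 / (a1 - z)\<^sup>2) = - of_real m2 * (2 * a2 / (a2 - z)\<^sup>2)" if z: "cmod z < 1" for z
  proof -
    have "z \<noteq> a1" using z a by auto
    have "om z = 2 * a1 / (a1 - a2) * ((a2 - z) / (z - a1))"
      unfolding om_eq[OF \<open>z \<noteq> a1\<close>] using a_nz by (simp add: divide_simps) (simp add: algebra_simps)
    then have sq: "(om z)\<^sup>2 = (2 * a1 / (a1 - a2))\<^sup>2 * (a2 - z)\<^sup>2 / (a1 - z)\<^sup>2"
      by (simp add: power_mult_distrib power_divide power2_commute)
    show ?thesis
      unfolding of_real_mult \<alpha>_eq sq using a_nz disc_nz[OF z] by (simp add: power2_eq_square divide_simps)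
  qed
  have PQ: "cgrad u (h z) * deriv h z = poly P z / poly Q z" if z: "cmod z < 1" for z
  proof -
    have ne: "z \<noteq> a1" "poly A z \<noteq> 0" "poly B z \<noteq> 0" using z a by (auto simp: AB)
    define w where "w = of_real s * om z"
    have w: "w = \<kappa> * poly B z / poly A z" using om[OF ne(1)] by (simp add: w_def)
    have "of_real (m2 * \<alpha>) / (om z)\<^sup>2 = of_real m1 / w\<^sup>2"
      unfolding s2 w_def by (simp add: power_mult_distrib)
    then have "of_real m2 * (2 * a2 / (a2 - z)\<^sup>2) = - (of_real m1 / w\<^sup>2 * (2 * a1 / (a1 - z)\<^sup>2))"
      using der2[OF z] by simp
    then have "cgrad u (h z) * deriv h z = of_real m1 * (2 * a1 / (a1 - z)\<^sup>2) - of_real m1 / w\<^sup>2 * (2 * a1 / (a1 - z)\<^sup>2)"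
      unfolding F'[OF z] by simp
    also have "\<dots> = of_real m1 * (2 * a1 / (a1 - z)\<^sup>2) * (1 - 1 / w\<^sup>2)"
      by (simp add: right_diff_distrib)
    also have "(a1 - z)\<^sup>2 = (poly A z)\<^sup>2" by (simp add: AB power2_commute)
    also have "1 - 1 / w\<^sup>2 = (\<kappa> * poly B z - poly A z) * (\<kappa> * poly B z + poly A z) / (\<kappa>\<^sup>2 * (poly B z)\<^sup>2)"
      unfolding w using ne \<kappa> by (simp add: field_simps power2_eq_square)
    finally show ?thesis unfolding P_def Q_def using ne \<kappa> by (simp add: power2_eq_square mult_ac)
  qed
  have Q0: "Q \<noteq> 0" using \<kappa> by (simp add: Q_def A_def B_def)
  \<comment> \<open>\<open>P1\<close> and \<open>Q1\<close> replace the two sides of the modulus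
    identity. In \<open>Q1\<close> the factor \<open>\<kappa> * B - A\<close>, which vanishes in the
    disc at \<open>w = 1\<close>, has become \<open>A + \<kappa> * B\<close>, which has no zero
    there because \<open>Re w > 0\<close>.\<close>
  define P1 where "P1 = A * A * (B * B) * p"
  define Q1 where "Q1 = (A + smult \<kappa> B)\<^sup>2 * q"
  have sym: "cmod (\<kappa> * poly B \<zeta> - poly A \<zeta>) = cmod (\<kappa> * poly B \<zeta> + poly A \<zeta>)" if \<zeta>: "cmod \<zeta> = 1" for \<zeta>
  proof (cases "\<zeta> = a1")
    case False
    define w where "w = of_real s * om \<zeta>"
    have "Re w = 0" unfolding w_def Re_of_real_times Re_om using \<zeta> by simp
    then have "cmod (w - 1) = cmod (w + 1)" by (simp add: cmod_def)
    moreover have "\<kappa> * poly B \<zeta> - poly A \<zeta> = (w - 1) * poly A \<zeta>" "\<kappa> * poly B \<zeta> + poly A \<zeta> = (w + 1) * poly A \<zeta>"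
      using om[OF False] False by (simp_all add: w_def AB field_simps)
    ultimately show ?thesis by (simp add: norm_mult)
  qed (simp add: AB)
  have mod: "cmod (poly P1 \<zeta>) = 2 * m1 / (c * (cmod \<kappa>)\<^sup>2) * cmod (poly Q1 \<zeta>)" if \<zeta>: "cmod \<zeta> = 1" for \<zeta>
  proof -
    have "cmod (poly P \<zeta> * poly q \<zeta>) = c * cmod (poly Q \<zeta> * poly p \<zeta>)"
      by (rule boundary_modulus_identity[OF nd N PQ Q0 \<zeta>])
    moreover have "cmod (poly P \<zeta> * poly q \<zeta>) = 2 * m1 * cmod (poly Q1 \<zeta>)"
      unfolding P_def Q1_def using m a sym[OF \<zeta>]
      by (simp add: norm_mult norm_power power2_eq_square add.commute[of "poly A \<zeta>"] mult_ac)
    moreover have "c * cmod (poly Q \<zeta> * poly p \<zeta>) = c * (cmod \<kappa>)\<^sup>2 * cmod (poly P1 \<zeta>)"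
      unfolding Q_def P1_def by (simp add: norm_mult norm_power mult_ac)
    ultimately show ?thesis using c \<kappa> by (simp add: field_simps)
  qed
  have w1: "poly A z + \<kappa> * poly B z = (1 + of_real s * om z) * poly A z" "1 + of_real s * om z \<noteq> 0" if z: "cmod z < 1" for z
  proof -
    have "z \<noteq> a1" using disc_nz[OF z] by auto
    then show "poly A z + \<kappa> * poly B z = (1 + of_real s * om z) * poly A z"
      unfolding om[OF \<open>z \<noteq> a1\<close>] using disc_nz[OF z] by (simp add: AB field_simps)
    have "Re (1 + of_real s * om z) > 0" using s Re_om_pos[OF z] by (simp add: add_pos_pos)
    then show "1 + of_real s * om z \<noteq> 0" by (metis less_irrefl zero_complex.sel(1))
  qed
  obtain K where K: "K \<noteq> 0" "P1 = smult K Q1"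
  proof (rule proportional_if_equal_modulus_on_circle[OF mod])
    show "2 * m1 / (c * (cmod \<kappa>)\<^sup>2) \<noteq> 0" using m c \<kappa> by simp
    show "poly P1 z \<noteq> 0" if z: "cmod z < 1" for z
      using poly_nz[OF z] disc_nz[OF z] by (simp add: P1_def AB)
    show "poly Q1 z \<noteq> 0" if z: "cmod z < 1" for z
      using poly_nz[OF z] disc_nz[OF z] w1[OF z] by (simp add: Q1_def AB)
  qed
  have 2: "deriv h z = K * \<kappa>\<^sup>2 / (2 * a1) * ((1 + of_real s * om z) / (of_real s * om z))\<^sup>2 * (2 * a1 / (a1 - z)\<^sup>2)" 
    if z: "cmod z < 1" for z
  proof -
    have ne: "z \<noteq> a1" "poly A z \<noteq> 0" "poly B z \<noteq> 0" using z a by (auto simp: AB)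
    define w where "w = of_real s * om z"
    have w: "\<kappa> * poly B z = w * poly A z" using om[OF ne(1)] ne by (simp add: w_def)
    then have w0: "w \<noteq> 0" using \<kappa> ne by auto
    have "poly P1 z = K * poly Q1 z" unfolding K(2) by simp
    then have "(poly A z)\<^sup>2 * (poly B z)\<^sup>2 * poly p z = K * (poly A z + \<kappa> * poly B z)\<^sup>2 * poly q z"
      by (simp add: P1_def Q1_def power2_eq_square mult_ac)
    also have "(poly A z + \<kappa> * poly B z) = (1 + w) * poly A z" by (simp add: w algebra_simps)
    finally have "(poly A z)\<^sup>2 * ((poly B z)\<^sup>2 * poly p z) = (poly A z)\<^sup>2 * (K * (1 + w)\<^sup>2 * poly q z)"
      by (simp add: power_mult_distrib mult_ac)
    then have "(poly B z)\<^sup>2 * poly p z = K * (1 + w)\<^sup>2 * poly q z" using ne by simp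
    then have "poly p z / poly q z = K * (1 + w)\<^sup>2 / (poly B z)\<^sup>2"
      using ne poly_nz[OF z] by (simp add: field_simps)
    also have "poly B z = w * poly A z / \<kappa>" using w \<kappa> by (simp add: field_simps)
    finally have "deriv h z = K * \<kappa>\<^sup>2 * ((1 + w) / w)\<^sup>2 / (poly A z)\<^sup>2"
      using deriv_h[of z] z \<kappa> w0 ne by (simp add: field_simps power_mult_distrib)
    also have "(poly A z)\<^sup>2 = (a1 - z)\<^sup>2" by (simp add: AB power2_commute)
    finally show ?thesis using a_nz by (simp add: w_def)
  qed
  show ?thesis
    by (rule that[OF s _ _ 1 2]) (use m s K \<kappa> a_nz in auto)
qed

text \<open>At points where \<open>om\<close> is a positive real \<open>x\<close>, moduli and square
  roots reduce the equation to one affine in \<open>1 / x\<close>; the values at 1 and 2 determine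
  both coefficients. This lets roof functions with a priori different scales share one
  similarity.\<close>

lemma scale_unique:
  assumes s: "s > 0" "s' > 0" and K: "K \<noteq> 0"
    and eq: "\<And>z. cmod z < 1 \<Longrightarrow> K * ((1 + of_real s * om z) / (of_real s * om z))\<^sup>2 * (2 * a1 / (a1 - z)\<^sup>2)
       = K' * ((1 + of_real s' * om z) / (of_real s' * om z))\<^sup>2 * (2 * a1 / (a1 - z)\<^sup>2)"
  shows "s = s'"
proof -
  have *: "sqrt (cmod K) * ((1 + s * x) / (s * x)) = sqrt (cmod K') * ((1 + s' * x) / (s' * x))" if x: "x > 0" for x :: real
  proof -
    obtain z where z: "cmod z < 1" "om z = of_real x" using om_surj[of "of_real x"] x by auto
    have "K * ((1 + of_real s * om z) / (of_real s * om z))\<^sup>2 = K' * ((1 + of_real s' * om z) / (of_real s' * om z))\<^sup>2"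
      using eq[OF z(1)] disc_nz[OF z(1)] a_nz by simp
    then have "K * of_real (((1 + s * x) / (s * x))\<^sup>2) = K' * of_real (((1 + s' * x) / (s' * x))\<^sup>2)"
      by (simp add: z(2))
    then have "cmod K * ((1 + s * x) / (s * x))\<^sup>2 = cmod K' * ((1 + s' * x) / (s' * x))\<^sup>2"
      by (metis abs_power2 norm_mult norm_of_real)
    then have "sqrt (cmod K * ((1 + s * x) / (s * x))\<^sup>2) = sqrt (cmod K' * ((1 + s' * x) / (s' * x))\<^sup>2)" by simp
    then show ?thesis using s x by (simp add: real_sqrt_mult add_pos_pos)
  qed
  define k k' where "k = sqrt (cmod K)" "k' = sqrt (cmod K')"
  have k: "k > 0" using K by (simp add: k_k'_def)
  have e1: "k * (1 / s + 1) = k' * (1 / s' + 1)"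
    using *[of 1] s by (simp add: k_k'_def field_simps)
  have e2: "k * (1 / s + 2) = k' * (1 / s' + 2)"
    using *[of 2] s by (simp add: k_k'_def field_simps)
  have "k = k'" using e1 e2 by (simp add: algebra_simps)
  with e1 k have "1 / s = 1 / s'" by simp
  then show ?thesis by simp
qed

section \<open>The strip coordinate and the explicit formulas in it\<close>

lemma Ln_strip_image:
  assumes s: "s > 0"
  shows "(\<lambda>z. Ln (of_real s * om z)) ` ball 0 1 = strip"
    and "\<And>w. w \<in> strip \<Longrightarrow> \<exists>z. cmod z < 1 \<and> of_real s * om z = exp w \<and> Ln (of_real s * om z) = w"
proof -
  show ex: "\<exists>z. cmod z < 1 \<and> of_real s * om z = exp w \<and> Ln (of_real s * om z) = w" if w: "w \<in> strip" for w
  proof -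
    have wi: "- (pi / 2) < Im w" "Im w < pi / 2" using w by (auto simp: strip_def abs_less_iff)
    then have "cos (Im w) > 0" by (intro cos_gt_zero_pi) auto
    then have "Re (exp w / of_real s) > 0" using s by (simp add: Re_exp)
    then obtain z where z: "cmod z < 1" "om z = exp w / of_real s" by (rule om_surj)
    then have "of_real s * om z = exp w" using s by simp
    moreover have "Ln (exp w) = w" using wi pi_gt_zero by (intro Ln_exp) auto
    ultimately show ?thesis using z(1) by auto
  qed
  show "(\<lambda>z. Ln (of_real s * om z)) ` ball 0 1 = strip"
  proof
    show "(\<lambda>z. Ln (of_real s * om z)) ` ball 0 1 \<subseteq> strip"
    proof clarify
      fix z :: complex assume "z \<in> ball 0 1"
      then have "Re (of_real s * om z) > 0" using Re_om_pos[of z] s by simp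
      then show "Ln (of_real s * om z) \<in> strip" using Re_Ln_pos_lt_imp by (simp add: strip_def)
    qed
    show "strip \<subseteq> (\<lambda>z. Ln (of_real s * om z)) ` ball 0 1"
      using ex by (force simp: image_iff)
  qed
qed

text \<open>In the coordinate \<open>Ln w\<close> with \<open>w = s * om\<close>, the factor
  \<open>((1 + w) / w)^2\<close> equals \<open>2 * (1 + cosh (Ln w)) / w\<close>. The term
  \<open>1 + cosh\<close> is the derivative of \<open>gmap\<close>, and the remaining
  \<open>1 / w\<close> is absorbed by the derivative of \<open>Ln w\<close>.\<close>

lemma h_strip_form:
  assumes s: "s > 0" 
    and d: "\<And>z. cmod z < 1 \<Longrightarrow> deriv h z = K * ((1 + of_real s * om z) / (of_real s * om z))\<^sup>2 * (2 * a1 / (a1 - z)\<^sup>2)"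
  obtains b where "\<And>z. cmod z < 1 \<Longrightarrow> h z = 2 * K / of_real s * gmap (Ln (of_real s * om z)) + b"
proof -
  let ?G = "\<lambda>z. 2 * K / of_real s * gmap (Ln (of_real s * om z))"
  have G: "(?G has_field_derivative deriv h z) (at z)" if z: "cmod z < 1" for z
  proof -
    define w where "w = of_real s * om z"
    define d1 where "d1 = 2 * a1 / (a1 - z)\<^sup>2"
    have Rew: "Re w > 0" using Re_om_pos[OF z] s by (simp add: w_def)
    then have w: "w \<noteq> 0" "w \<notin> \<real>\<^sub>\<le>\<^sub>0" by (auto simp: complex_nonpos_Reals_iff)
    have "((\<lambda>z. of_real s * om z) has_field_derivative of_real s * d1) (at z)"
      unfolding d1_def using disc_nz[OF z] by (intro DERIV_cmult om_has_deriv) auto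
    from DERIV_chain2[OF has_field_derivative_Ln this] w(2)
    have L: "((\<lambda>z. Ln (of_real s * om z)) has_field_derivative inverse w * (of_real s * d1)) (at z)"
      by (simp add: w_def)
    have g: "(gmap has_field_derivative 1 + cosh x) (at x)" for x
      unfolding gmap_def by (auto intro!: derivative_eq_intros)
    have "(?G has_field_derivative 2 * K / of_real s * ((1 + cosh (Ln w)) * (inverse w * (of_real s * d1)))) (at z)"
      using DERIV_cmult[OF DERIV_chain2[OF g L]] unfolding w_def .
    moreover have "2 * K / of_real s * ((1 + cosh (Ln w)) * (inverse w * (of_real s * d1))) = deriv h z"
    proof -
      have "cosh (Ln w) = (w + inverse w) / 2"
        using w by (simp add: cosh_field_def exp_minus)
      then have "2 * (1 + cosh (Ln w)) * inverse w = ((1 + w) / w)\<^sup>2"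
        using w by (simp add: field_simps power2_eq_square)
      moreover have "2 * K / of_real s * ((1 + cosh (Ln w)) * (inverse w * (of_real s * d1))) = K * (2 * (1 + cosh (Ln w)) * inverse w) * d1"
        using s by simp
      ultimately show ?thesis using d[OF z] by (simp add: w_def d1_def)
    qed
    ultimately show ?thesis by simp
  qed
  have "((\<lambda>z. h z - ?G z) has_field_derivative 0) (at z within ball 0 1)" if "z \<in> ball 0 1" for z
  proof -
    have "(h has_field_derivative deriv h z) (at z)" by (rule holomorphic_derivI[OF hol open_ball that])
    from DERIV_diff[OF this G[of z]] that show ?thesis by (auto intro: has_field_derivative_at_within)
  qed
  then have "\<exists>b. \<forall>z\<in>ball 0 1. h z - ?G z = b"
    by (rule has_field_derivative_zero_constant[OF convex_ball])
  then obtain b where "\<forall>z\<in>ball 0 1. h z - ?G z = b" ..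
  then have "h z = ?G z + b" if "cmod z < 1" for z using that by (metis diff_add_cancel add.commute mem_ball_0)
  then show ?thesis by (rule that)
qed

text \<open>Pulled back to the disc, \<open>f\<close> has the same real part as
  \<open>C * (w + 1 / w)\<close>, so they differ by an imaginary constant; with \<open>w\<close> an
  exponential the sum is twice a \<open>cosh\<close>.\<close>

lemma completion_eq_cosh:
  assumes s: "s > 0" and U: "\<And>z. cmod z < 1 \<Longrightarrow> u (h z) = C * Re (of_real s * om z + 1 / (of_real s * om z))"
    and hz: "\<And>z. cmod z < 1 \<Longrightarrow> h z = k * gmap (Ln (of_real s * om z)) + b"
    and f: "f holomorphic_on \<Omega>" "\<And>z. z \<in> \<Omega> \<Longrightarrow> Re (f z) = u z"
  shows "\<exists>t::real. \<forall>w\<in>strip. f (k * gmap w + b) = of_real (2 * C) * cosh w + \<i> * of_real t"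
proof -
  let ?G = "\<lambda>z. of_real C * (of_real s * om z + 1 / (of_real s * om z))"
  have "om holomorphic_on ball 0 1"
    unfolding om_def using disc_nz by (intro holomorphic_intros) auto
  then have "?G holomorphic_on ball 0 1"
    using om_nz s by (intro holomorphic_intros) auto
  moreover have "(\<lambda>z. f (h z)) holomorphic_on ball 0 1"
    using holomorphic_on_compose_gen[OF hol f(1)] img by (simp add: o_def)
  moreover have "Re (f (h z)) = Re (?G z)" if "z \<in> ball 0 1" for z
    using f(2)[of "h z"] U[of z] that img unfolding Re_of_real_times by auto
  ultimately obtain t :: real where t: "\<forall>z\<in>ball 0 1. f (h z) = ?G z + \<i> * of_real t"
    using holomorphic_Re_eq_imp_diff_const[of "ball 0 1" "\<lambda>z. f (h z)" ?G] by auto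
  have "f (k * gmap w + b) = of_real (2 * C) * cosh w + \<i> * of_real t" if w: "w \<in> strip" for w
  proof -
    obtain z where z: "cmod z < 1" "of_real s * om z = exp w" "Ln (of_real s * om z) = w"
      using Ln_strip_image(2)[OF s w] by blast
    have "f (h z) = ?G z + \<i> * of_real t" using t z(1) by simp
    also have "?G z = of_real (2 * C) * cosh w"
      unfolding z(2) by (simp add: cosh_field_def exp_minus inverse_eq_divide)
    finally show ?thesis using hz[OF z(1)] z(3) by simp
  qed
  then show ?thesis by blast
qed

end

theorem theorem6p1:
  fixes \<Omega> :: "complex set" and h :: "complex \<Rightarrow> complex"
    and p q :: "complex poly"
  assumes "open \<Omega>" and "connected \<Omega>" and "simply_connected \<Omega>" and "\<Omega> \<noteq> UNIV"
    and "h holomorphic_on ball 0 1" and "inj_on h (ball 0 1)" and "h ` ball 0 1 = \<Omega>"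
    and "smirnov_map h"
    and "exceptional_weak \<Omega>"
    and "q \<noteq> 0" and "coprime p q"
    and "\<forall>z\<in>ball 0 1. deriv h z = poly p z / poly q z"
    and "card {z. cmod z = 1 \<and> poly q z = 0} = 2"
  shows "\<exists>a b. a \<noteq> 0 \<and> \<Omega> = (\<lambda>w. a * gmap w + b) ` strip \<and>
     (\<forall>u. roof_function \<Omega> u \<longrightarrow>
        (\<exists>c>0. \<forall>f. f holomorphic_on \<Omega> \<and> (\<forall>z\<in>\<Omega>. Re (f z) = u z) \<longrightarrow>
           (\<exists>k::real. \<forall>w\<in>strip. f (a * gmap w + b) = complex_of_real c * cosh w + \<i> * complex_of_real k)))"
proof -
  obtain a1 a2 where Z: "{z. cmod z = 1 \<and> poly q z = 0} = {a1, a2}" and "a1 \<noteq> a2"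
    using assms(13) by (metis card_2_iff)
  interpret two_pole_map \<Omega> h p q a1 a2
    using assms Z \<open>a1 \<noteq> a2\<close> by unfold_locales blast+
  \<comment> \<open>\<open>u0\<close> serves only to fix the scale and the similarity; the formula
    for the completion is proved afterwards for every roof function.\<close>
  obtain u0 where "roof_function \<Omega> u0" using assms(9) by (auto simp: exceptional_weak_def)
  then obtain s C0 K where s: "s > 0" and K: "K \<noteq> 0"
    and dh: "\<And>z. cmod z < 1 \<Longrightarrow> deriv h z = K * ((1 + of_real s * om z) / (of_real s * om z))\<^sup>2 * (2 * a1 / (a1 - z)\<^sup>2)"
    by (rule roof_normal_form) blast
  obtain b where hb: "\<And>z. cmod z < 1 \<Longrightarrow> h z = 2 * K / of_real s * gmap (Ln (of_real s * om z)) + b"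
    by (rule h_strip_form[OF s dh]) blast+
  let ?a = "2 * K / of_real s"
  have "h ` ball 0 1 = (\<lambda>w. ?a * gmap w + b) ` (\<lambda>z. Ln (of_real s * om z)) ` ball 0 1"
    unfolding image_image by (rule image_cong) (use hb in auto)
  then have im: "\<Omega> = (\<lambda>w. ?a * gmap w + b) ` strip"
    using Ln_strip_image(1)[OF s] img by simp
  have main: "\<exists>c>0. \<forall>f. f holomorphic_on \<Omega> \<and> (\<forall>z\<in>\<Omega>. Re (f z) = u z) \<longrightarrow>
           (\<exists>k::real. \<forall>w\<in>strip. f (?a * gmap w + b) = complex_of_real c * cosh w + \<i> * complex_of_real k)"
    if u: "roof_function \<Omega> u" for u
  proof -
    obtain s' C K' where s': "s' > 0" and C: "C > 0"
      and U: "\<And>z. cmod z < 1 \<Longrightarrow> u (h z) = C * Re (of_real s' * om z + 1 / (of_real s' * om z))"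
      and dh': "\<And>z. cmod z < 1 \<Longrightarrow> deriv h z = K' * ((1 + of_real s' * om z) / (of_real s' * om z))\<^sup>2 * (2 * a1 / (a1 - z)\<^sup>2)"
      by (rule roof_normal_form[OF u]) blast
    \<comment> \<open>Both normal forms describe the same \<open>deriv h\<close>, so only the
      amplitude \<open>C\<close> can vary with the roof function.\<close>
    have "s = s'" by (rule scale_unique[OF s s' K], rule trans[OF sym[OF dh] dh'])
    with U have U': "\<And>z. cmod z < 1 \<Longrightarrow> u (h z) = C * Re (of_real s * om z + 1 / (of_real s * om z))" by simp
    show ?thesis
    proof (rule exI[of _ "2 * C"], intro conjI allI impI)
      fix f assume "f holomorphic_on \<Omega> \<and> (\<forall>z\<in>\<Omega>. Re (f z) = u z)"
      then show "\<exists>k::real. \<forall>w\<in>strip. f (?a * gmap w + b) = complex_of_real (2 * C) * cosh w + \<i> * complex_of_real k"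
        by (intro completion_eq_cosh[OF s U' hb]) auto
    qed (use C in simp)
  qed
  have "?a \<noteq> 0" using s K by simp
  with im main show ?thesis by blast
qed

end
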